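(* Let $R(p,\vec m,X)$ (with $p\in\omega$, $\vec m$ a tuple of integers of fixed length, $X\in{}^{\omega}2$) be a feedback semi-computable relation such that $\forall\vec m\,\forall X\,\exists p\;R(p,\vec m,X)$. Then there is a partial feedback computable choice function $F$ such that for all $\vec m$ and all $X$, $F(\vec m,X)$ is defined and $R(F(\vec m,X),\vec m,X)$ holds.
   Context: **Feedback computation.** Programs are ordinary oracle Turing machine programs (with oracle $X$), indexed by $e\in\omega$ in a standard way, with an additional instruction allowing the machine at any stage to issue a query $Q^X(e',m')$, with $e',m'$ integers computed by the machine, asking whether the feedback computation $\langle e'\rangle^X(m')$ converges or diverges, and receiving (in one step) an answer in $\{\downarrow,\uparrow\}$. Finite sequences of integers are coded by integers, so an input $m$ may be a tuple. Formally, for a partial function $C$ let $I(C)$ be the set of pairs $\langle\langle e,m,X\rangle,\langle j,k\rangle\rangle$ such that program $e$, run on input $m$ with oracle $X$, makes only queries $Q^X(e',m')$ for which $C(\langle e',m',X\rangle)=\langle j',k'\rangle$ is defined, each such query being answered by $j'$, and either this run halts with output $k\in\omega$ and $j=\,\downarrow$, or it runs forever and $j=\,\uparrow$, $k=\omega$. Let $I_\infty$ be the least fixed point of the monotone operator $I$, obtained by iteration from $\emptyset$. Write $\langle e\rangle^X(m)\downarrow k$ iff $I_\infty(\langle e,m,X\rangle)=\langle\downarrow,k\rangle$, and $\langle e\rangle^X(m)\downarrow$ iff this holds for some $k\in\omega$. A relation $R(p,\vec m,X)$ with an oracle argument is feedback semi-computable if there is a single index $e\in\omega$ such that for all $p,\vec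 m,X$: $R(p,\vec m,X)\iff\langle e\rangle^X(p,\vec m)\downarrow$. A function $F(\vec m,X)$ is partial feedback computable if there is a single index $f\in\omega$ with $F(\vec m,X)\simeq\langle f\rangle^X(\vec m)$ for all $\vec m,X$. *)

theory Defs
  imports "HOL-Library.Nat_Bijection"
begin

text \<open>
  Turing machines with finitely many two-way infinite tapes over the symbols blank
  (\<^const>\<open>False\<close>) and 1 (\<^const>\<open>True\<close>).  A tape is a pair \<open>(l, r)\<close>: \<open>l\<close> lists the cells to the
  left of the head, nearest first; \<open>r\<close> lists the scanned cell and those to its right; all cells
  not listed are blank.
\<close>

type_synonym tape = "bool list \<times> bool list"

datatype dir = Left | Right | Stay

fun scanned :: "tape \<Rightarrow> bool" where
  "scanned (l, r) \<longleftrightarrow> r \<noteq> [] \<and> hd r"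

fun put :: "bool \<Rightarrow> tape \<Rightarrow> tape" where
  "put b (l, r) = (l, b # tl r)"

fun move :: "dir \<Rightarrow> tape \<Rightarrow> tape" where
  "move Left (l, r) = (tl l, (l \<noteq> [] \<and> hd l) # r)"
| "move Right (l, r) = (scanned (l, r) # l, tl r)"
| "move Stay (l, r) = (l, r)"

text \<open>The integer held by a tape is its number of 1s.\<close>

fun tape_val :: "tape \<Rightarrow> nat" where
  "tape_val (l, r) = count_list (l @ r) True"

text \<open>
  A program is the list of the instructions of its states \<open>0, 1, \<dots>\<close>; it mentions only finitely
  many tapes.

  \<^item> \<open>Act t a0 a1\<close>: perform \<open>a0\<close> or \<open>a1\<close> according to whether tape \<open>t\<close> scans blank or 1, an action
    \<open>(b, d, q)\<close> being: write \<open>b\<close> on tape \<open>t\<close>, move its head in direction \<open>d\<close>, enter state \<open>q\<close>.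
  \<^item> \<open>Oracle t q1 q0\<close>: enter \<open>q1\<close> or \<open>q0\<close> according to whether the integer on tape \<open>t\<close> is in the
    oracle.
  \<^item> \<open>Query s t q1 q0\<close>: with \<open>e'\<close>, \<open>m'\<close> the integers on tapes \<open>s\<close>, \<open>t\<close>, issue the feedback query
    whether program \<open>e'\<close> converges on \<open>m'\<close>; enter \<open>q1\<close> if the answer is convergence and \<open>q0\<close> if
    it is divergence.
\<close>

type_synonym action = "bool \<times> dir \<times> nat"

datatype instr =
    Act nat action action
  | Oracle nat nat nat
  | Query nat nat nat nat

type_synonym program = "instr list"

definition decode_action :: "nat \<Rightarrow> action" where
  "decode_action n =
     (odd n, if n div 2 mod 3 = 0 then Left else if n div 2 mod 3 = 1 then Right else Stay, n div 6)"

definition decode_instr :: "nat \<Rightarrow> instr" where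
  "decode_instr n =
     (let (a, b) = prod_decode (n div 3); (c, d) = prod_decode b in
      if n mod 3 = 0 then Act a (decode_action c) (decode_action d)
      else if n mod 3 = 1 then Oracle a c d
      else let (d0, d1) = prod_decode d in Query a c d0 d1)"

definition prog :: "nat \<Rightarrow> program" where
  "prog e = map decode_instr (list_decode e)"

lemma surj_decode_action: "surj decode_action"
  unfolding surj_def
proof (rule allI)
  fix a :: action
  obtain b d q where a: "a = (b, d, q)" by (cases a) auto
  define i :: nat where "i = (case d of Left \<Rightarrow> 0 | Right \<Rightarrow> 1 | Stay \<Rightarrow> 2)"
  define n where "n = 6 * q + 2 * i + (if b then 1 else 0)"
  have i: "i < 3" by (simp add: i_def split: dir.split)
  have "n div 6 = q" "n div 2 mod 3 = i" "odd n = b"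
    using i unfolding n_def by (cases b; simp; presburger)+
  then have "decode_action n = a"
    unfolding decode_action_def a by (cases d) (simp_all only: i_def, simp_all)
  then show "\<exists>n. a = decode_action n" by blast
qed

lemma surj_decode_instr: "surj decode_instr"
  unfolding surj_def
proof (rule allI)
  fix i :: instr
  have div_mod: "(3 * x + 1) div 3 = x" "(3 * x + 1) mod 3 = 1"
    "(3 * x + 2) div 3 = x" "(3 * x + 2) mod 3 = 2" for x :: nat
    by presburger+
  show "\<exists>n. i = decode_instr n"
  proof (cases i)
    case (Act t a0 a1)
    obtain c d where "decode_action c = a0" "decode_action d = a1"
      using surj_decode_action by (metis surjD)
    then have "decode_instr (3 * prod_encode (t, prod_encode (c, d))) = i"
      by (simp add: decode_instr_def Act)
    then show ?thesis by metis
  next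
    case (Oracle t q1 q0)
    then have "decode_instr (3 * prod_encode (t, prod_encode (q1, q0)) + 1) = i"
      unfolding decode_instr_def div_mod by simp
    then show ?thesis by metis
  next
    case (Query s t q1 q0)
    then have "decode_instr (3 * prod_encode (s, prod_encode (t, prod_encode (q1, q0))) + 2) = i"
      unfolding decode_instr_def div_mod by simp
    then show ?thesis by metis
  qed
qed

lemma surj_prog: "surj prog"
  unfolding surj_def
proof (rule allI)
  fix p :: program
  have "\<exists>ns. map decode_instr ns = p"
  proof (induction p)
    case (Cons i p)
    then obtain n ns where "decode_instr n = i" "map decode_instr ns = p"
      using surj_decode_instr by (metis surjD)
    then have "map decode_instr (n # ns) = i # p" by simp
    then show ?case by (rule exI)
  qed simp
  then show "\<exists>e. p = prog e" by (metis prog_def list_encode_inverse)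
qed

text \<open>A configuration consists of the current state and the tapes; almost all tapes are blank.\<close>

type_synonym config = "nat \<times> (nat \<Rightarrow> tape)"

text \<open>Input and output are on tape 0; at the start, its head is just to the right of the input.\<close>

definition init :: "nat \<Rightarrow> config" where
  "init m = (0, (\<lambda>_. ([], []))(0 := (replicate m True, [])))"

definition halted :: "program \<Rightarrow> config \<Rightarrow> bool" where
  "halted p c \<longleftrightarrow> length p \<le> fst c"

definition result :: "config \<Rightarrow> nat" where
  "result c = tape_val (snd c 0)"

text \<open>\<open>A e' m'\<close> is the answer to the feedback query about \<open>e'\<close> and \<open>m'\<close>, \<^const>\<open>True\<close> meaning convergence.\<close>

definition step :: "(nat \<Rightarrow> bool) \<Rightarrow> (nat \<Rightarrow> nat \<Rightarrow> bool) \<Rightarrow> program \<Rightarrow> config \<Rightarrow> config" where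
  "step X A p c =
     (if halted p c then c else
      let (q, T) = c in
      case p ! q of
        Act t a0 a1 \<Rightarrow>
          let (b, d, q') = (if scanned (T t) then a1 else a0)
          in (q', T(t := move d (put b (T t))))
      | Oracle t q1 q0 \<Rightarrow> (if X (tape_val (T t)) then q1 else q0, T)
      | Query s t q1 q0 \<Rightarrow> (if A (tape_val (T s)) (tape_val (T t)) then q1 else q0, T))"

definition queries :: "program \<Rightarrow> config \<Rightarrow> nat \<Rightarrow> nat \<Rightarrow> bool" where
  "queries p c e' m' \<longleftrightarrow>
     \<not> halted p c \<and>
     (\<exists>s t q1 q0. p ! fst c = Query s t q1 q0 \<and>
        e' = tape_val (snd c s) \<and> m' = tape_val (snd c t))"

definition run :: "(nat \<Rightarrow> bool) \<Rightarrow> (nat \<Rightarrow> nat \<Rightarrow> bool) \<Rightarrow> nat \<Rightarrow> nat \<Rightarrow> nat \<Rightarrow> config" where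
  "run X A e m n = (step X A (prog e) ^^ n) (init m)"

text \<open>
  \<open>Converges k\<close> is the pair \<open>\<langle>\<down>, k\<rangle>\<close> and \<open>Diverges\<close> is the pair \<open>\<langle>\<up>, \<omega>\<rangle>\<close>.
\<close>

datatype outcome = is_conv: Converges nat | Diverges

fun has_outcome :: "(nat \<Rightarrow> bool) \<Rightarrow> (nat \<Rightarrow> nat \<Rightarrow> bool) \<Rightarrow> nat \<Rightarrow> nat \<Rightarrow> outcome \<Rightarrow> bool" where
  "has_outcome X A e m (Converges k) \<longleftrightarrow>
     (\<exists>n. halted (prog e) (run X A e m n) \<and> result (run X A e m n) = k)"
| "has_outcome X A e m Diverges \<longleftrightarrow> (\<forall>n. \<not> halted (prog e) (run X A e m n))"

text \<open>
  The partial functions \<open>C\<close> to which the operator \<open>I\<close> is applied are represented by their graphs.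
  \<open>A\<close> is constrained by \<open>C\<close> at the queries actually made, and irrelevant elsewhere.
\<close>

type_synonym computations = "((nat \<times> nat \<times> (nat \<Rightarrow> bool)) \<times> outcome) set"

definition fb_op :: "computations \<Rightarrow> computations" where
  "fb_op C = {((e, m, X), r) | e m X r. \<exists>A.
     (\<forall>n e' m'. queries (prog e) (run X A e m n) e' m' \<longrightarrow>
        (\<exists>r'. ((e', m', X), r') \<in> C \<and> A e' m' = is_conv r')) \<and>
     has_outcome X A e m r}"

definition I_infty :: computations where
  "I_infty = lfp fb_op"

lemma mono_fb_op: "mono fb_op"
proof (rule monoI, rule subsetI)
  fix C D :: computations and z
  assume "C \<subseteq> D" "z \<in> fb_op C"
  then obtain e m X r A where z: "z = ((e, m, X), r)"
    and A: "\<forall>n e' m'. queries (prog e) (run X A e m n) e' m' \<longrightarrow>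
      (\<exists>r'. ((e', m', X), r') \<in> C \<and> A e' m' = is_conv r')"
    and r: "has_outcome X A e m r"
    unfolding fb_op_def by (elim CollectE exE conjE) (rule that)
  have "\<forall>n e' m'. queries (prog e) (run X A e m n) e' m' \<longrightarrow>
      (\<exists>r'. ((e', m', X), r') \<in> D \<and> A e' m' = is_conv r')"
    using A \<open>C \<subseteq> D\<close> by (meson subsetD)
  with r show "z \<in> fb_op D"
    unfolding fb_op_def z by (intro CollectI exI conjI) (rule refl)
qed

lemma I_infty_unfold: "I_infty = fb_op I_infty"
  unfolding I_infty_def by (rule lfp_unfold[OF mono_fb_op])

lemma step_cong:
  assumes "\<And>e' m'. queries p c e' m' \<Longrightarrow> A e' m' = B e' m'"
  shows "step X A p c = step X B p c"
proof (cases "halted p c")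
  case False
  obtain q T where c: "c = (q, T)" by fastforce
  show ?thesis
  proof (cases "p ! q")
    case (Query s t q1 q0)
    then have "queries p c (tape_val (T s)) (tape_val (T t))"
      using False by (auto simp: queries_def c)
    then show ?thesis
      using Query assms by (simp add: step_def c)
  qed (auto simp: step_def c)
qed (simp add: step_def)

lemma run_cong:
  assumes "\<And>n e' m'. queries (prog e) (run X A e m n) e' m' \<Longrightarrow>
      queries (prog e) (run X B e m n) e' m' \<Longrightarrow> A e' m' = B e' m'"
  shows "run X A e m n = run X B e m n"
proof (induction n)
  case 0
  show ?case by (simp add: run_def)
next
  case (Suc n)
  have S: "run X D e m (Suc n) = step X D (prog e) (run X D e m n)" for D
    by (simp add: run_def)
  show ?case
    unfolding S Suc by (rule step_cong) (use assms Suc in metis)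
qed

lemma run_halted:
  assumes "halted (prog e) (run X A e m i)" and "i \<le> j"
  shows "run X A e m j = run X A e m i"
  using assms(2)
proof (induction j rule: dec_induct)
  case (step n)
  then show ?case using assms(1) by (simp add: run_def step_def)
qed simp

lemma has_outcome_unique:
  assumes "has_outcome X A e m r" and "has_outcome X A e m s"
  shows "r = s"
proof (cases r; cases s)
  fix k l assume rs: "r = Converges k" "s = Converges l"
  then obtain i j where
    "halted (prog e) (run X A e m i)" "result (run X A e m i) = k"
    "halted (prog e) (run X A e m j)" "result (run X A e m j) = l"
    using assms by auto
  then show ?thesis using run_halted rs by (metis nat_le_linear)
qed (use assms in auto)

text \<open>
  The least fixed point among all relations is single-valued, hence it is also the least fixed
  point among the graphs of partial functions.
\<close>

lemma single_valued_I_infty: "single_valued I_infty"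
proof -
  define D where "D = {z \<in> I_infty. \<forall>s. (fst z, s) \<in> I_infty \<longrightarrow> s = snd z}"
  have D_iff: "(x, r) \<in> D \<longleftrightarrow> (x, r) \<in> I_infty \<and> (\<forall>s. (x, s) \<in> I_infty \<longrightarrow> s = r)" for x r
    by (simp add: D_def)
  have "fb_op (I_infty \<inter> D) \<subseteq> D"
  proof
    fix z assume z: "z \<in> fb_op (I_infty \<inter> D)"
    then have "z \<in> fb_op I_infty"
      using mono_fb_op by (meson Int_lower1 monoD subsetD)
    then have zI: "z \<in> I_infty"
      by (subst I_infty_unfold)
    from z obtain e m X r A where z': "z = ((e, m, X), r)"
      and A: "\<forall>n e' m'. queries (prog e) (run X A e m n) e' m' \<longrightarrow>
        (\<exists>r'. ((e', m', X), r') \<in> I_infty \<inter> D \<and> A e' m' = is_conv r')"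
      and r: "has_outcome X A e m r"
      unfolding fb_op_def by (elim CollectE exE conjE) (rule that)
    have "\<forall>s. ((e, m, X), s) \<in> I_infty \<longrightarrow> s = r"
    proof (intro allI impI)
      fix s assume sI: "((e, m, X), s) \<in> I_infty"
      have "((e, m, X), s) \<in> fb_op I_infty"
        using sI by (subst (asm) I_infty_unfold)
      then obtain B where B: "\<forall>n e' m'. queries (prog e) (run X B e m n) e' m' \<longrightarrow>
          (\<exists>r'. ((e', m', X), r') \<in> I_infty \<and> B e' m' = is_conv r')"
        and s: "has_outcome X B e m s"
        unfolding fb_op_def by auto
      have run: "run X A e m n = run X B e m n" for n
      proof (rule run_cong)
        fix n e' m'
        assume "queries (prog e) (run X A e m n) e' m'" "queries (prog e) (run X B e m n) e' m'"
        with A B obtain a b where "((e', m', X), a) \<in> D" "A e' m' = is_conv a"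
          "((e', m', X), b) \<in> I_infty" "B e' m' = is_conv b"
          by (meson IntD2)
        then show "A e' m' = B e' m'" unfolding D_iff by metis
      qed
      have "has_outcome X A e m s"
        using s by (cases s) (simp_all add: run)
      then show "s = r" using r by (rule has_outcome_unique)
    qed
    then show "z \<in> D" using zI unfolding z' D_iff by (intro conjI)
  qed
  then have "I_infty \<subseteq> D"
    unfolding I_infty_def by (rule lfp_induct[OF mono_fb_op])
  then have "s = r" if "(x, r) \<in> I_infty" "(x, s) \<in> I_infty" for x r s
    using that D_iff by (meson subsetD)
  then show ?thesis unfolding single_valued_def by metis
qed

definition fb_conv_to :: "nat \<Rightarrow> (nat \<Rightarrow> bool) \<Rightarrow> nat \<Rightarrow> nat \<Rightarrow> bool" where
  "fb_conv_to e X m k \<longleftrightarrow> ((e, m, X), Converges k) \<in> I_infty"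

definition fb_conv :: "nat \<Rightarrow> (nat \<Rightarrow> bool) \<Rightarrow> nat \<Rightarrow> bool" where
  "fb_conv e X m \<longleftrightarrow> (\<exists>k. fb_conv_to e X m k)"

text \<open>
  Relations \<open>R(p, m, X)\<close> and partial functions \<open>F(m, X)\<close>, where \<open>m\<close> ranges over the \<open>n\<close>-tuples; their
  values on lists \<open>m\<close> of a different length are irrelevant.
\<close>

definition fb_semicomputable ::
    "nat \<Rightarrow> (nat \<Rightarrow> nat list \<Rightarrow> (nat \<Rightarrow> bool) \<Rightarrow> bool) \<Rightarrow> bool" where
  "fb_semicomputable n R \<longleftrightarrow>
     (\<exists>e. \<forall>p ms X. length ms = n \<longrightarrow> (R p ms X \<longleftrightarrow> fb_conv e X (list_encode (p # ms))))"

definition partial_fb_computable ::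
    "nat \<Rightarrow> (nat list \<Rightarrow> (nat \<Rightarrow> bool) \<Rightarrow> nat option) \<Rightarrow> bool" where
  "partial_fb_computable n F \<longleftrightarrow>
     (\<exists>f. \<forall>ms X. length ms = n \<longrightarrow>
        (\<forall>k. F ms X = Some k \<longleftrightarrow> fb_conv_to f X (list_encode ms) k))"

end

theory Submission
  imports Defs
begin

text \<open>
  Gandy selection.  Two computations \<open>x\<close> and \<open>y\<close> are raced against each other: both are simulated up
  to their pending queries \<open>q\<close> and \<open>q'\<close>, and a recursive comparison of \<open>q\<close> and \<open>q'\<close> tells which of
  the two may safely be asked, so that one of the simulations can advance.  If \<open>x\<close> or \<open>y\<close> is
  defined, induction on its definition shows that the race never freezes and that the winner, a
  simulation that makes infinitely many moves, is defined; the winner can be determined because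
  feedback decides whether \<open>x\<close> makes infinitely many moves.

  With \<open>x p\<close> the computation that semi-decides \<open>R p\<close>, let \<open>h p\<close> compare \<open>x p\<close> with \<open>h (p + 1)\<close>: if
  \<open>x p\<close> wins, ask whether it converges and, if so, halt; otherwise ask \<open>h (p + 1)\<close> and diverge.  Then
  \<open>h p\<close> is defined for \<open>p\<close> up to some witness of \<open>R\<close>, and as a diverging \<open>h p\<close> asks \<open>h (p + 1)\<close>,
  well-foundedness yields a first converging \<open>h p\<close>, whose \<open>p\<close> satisfies \<open>R\<close>.
\<close>

section \<open>A register language and its compilation to Turing machines\<close>

datatype test = Pos nat | Orc nat | Qry nat nat

datatype cmd = Skip | Inc nat | Seq cmd cmd (infixr ";;" 60) | Cond test cmd cmd | While test cmd

type_synonym regs = "nat \<Rightarrow> nat"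

fun holds_test :: "(nat \<Rightarrow> bool) \<Rightarrow> (nat \<Rightarrow> nat \<Rightarrow> bool) \<Rightarrow> regs \<Rightarrow> test \<Rightarrow> bool" where
  "holds_test X A s (Pos r) \<longleftrightarrow> s r \<noteq> 0"
| "holds_test X A s (Orc t) \<longleftrightarrow> X (s t)"
| "holds_test X A s (Qry t u) \<longleftrightarrow> A (s t) (s u)"

text \<open>The test \<open>Pos r\<close> also decrements the register \<open>r\<close>.\<close>

fun after_test :: "regs \<Rightarrow> test \<Rightarrow> regs" where
  "after_test s (Pos r) = s(r := s r - 1)"
| "after_test s t = s"

fun test_queries :: "regs \<Rightarrow> test \<Rightarrow> (nat \<times> nat) set" where
  "test_queries s (Qry t u) = {(s t, s u)}"
| "test_queries s t = {}"

text \<open>The set of feedback queries is part of the judgement because definedness of a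
  computation depends on exactly which queries are issued. Only terminating executions are covered;
  infinite runs are dealt with later, for one outermost loop.\<close>

inductive big_step :: "(nat \<Rightarrow> bool) \<Rightarrow> (nat \<Rightarrow> nat \<Rightarrow> bool) \<Rightarrow> cmd \<Rightarrow> regs \<Rightarrow> (nat \<times> nat) set \<Rightarrow> regs \<Rightarrow> bool"
  for X A where
  Skip: "big_step X A Skip s {} s"
| Inc: "big_step X A (Inc r) s {} (s(r := Suc (s r)))"
| Seq: "big_step X A a s Q s' \<Longrightarrow> big_step X A b s' Q' s'' \<Longrightarrow> big_step X A (a ;; b) s (Q \<union> Q') s''"
| Cond_yes: "holds_test X A s t \<Longrightarrow> big_step X A a (after_test s t) Q s' \<Longrightarrow>
    big_step X A (Cond t a b) s (test_queries s t \<union> Q) s'"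
| Cond_no: "\<not> holds_test X A s t \<Longrightarrow> big_step X A b (after_test s t) Q s' \<Longrightarrow>
    big_step X A (Cond t a b) s (test_queries s t \<union> Q) s'"
| While_no: "\<not> holds_test X A s t \<Longrightarrow>
    big_step X A (While t a) s (test_queries s t) (after_test s t)"
| While_yes: "holds_test X A s t \<Longrightarrow> big_step X A a (after_test s t) Q s' \<Longrightarrow>
    big_step X A (While t a) s' Q' s'' \<Longrightarrow>
    big_step X A (While t a) s (test_queries s t \<union> Q \<union> Q') s''"

section \<open>Compilation of commands to Turing machine code\<close>

text \<open>The head rests on the blank just right of the block of 1s. For \<open>Pos r\<close> the
  first instruction steps left; the second finds either a blank, so that the register is 0 and the
  head steps back, or the last 1, which it erases without moving on. Jump targets are absolute,
  \<open>no\<close> being the target of a failed test.\<close>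

fun header_code :: "nat \<Rightarrow> nat \<Rightarrow> test \<Rightarrow> program" where
  "header_code k no (Pos r) =
     [Act r (False, Left, Suc k) (True, Left, Suc k),
      Act r (False, Right, no) (False, Stay, Suc (Suc k))]"
| "header_code k no (Orc t) = [Oracle t (Suc k) no]"
| "header_code k no (Qry s t) = [Query s t (Suc k) no]"

text \<open>There is no jump instruction; rewriting the scanned symbol of tape 0 without moving
  serves as one.\<close>

definition goto :: "nat \<Rightarrow> instr" where
  "goto k = Act 0 (False, Stay, k) (True, Stay, k)"

fun test_size :: "test \<Rightarrow> nat" where
  "test_size (Pos r) = 2"
| "test_size t = 1"

fun cmd_size :: "cmd \<Rightarrow> nat" where
  "cmd_size Skip = 0"
| "cmd_size (Inc r) = 1"
| "cmd_size (a ;; b) = cmd_size a + cmd_size b"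
| "cmd_size (Cond t a b) = test_size t + cmd_size a + 1 + cmd_size b"
| "cmd_size (While t a) = test_size t + cmd_size a + 1"

fun code :: "nat \<Rightarrow> cmd \<Rightarrow> program" where
  "code k Skip = []"
| "code k (Inc r) = [Act r (True, Right, Suc k) (True, Right, Suc k)]"
| "code k (a ;; b) = code k a @ code (k + cmd_size a) b"
| "code k (Cond t a b) =
     (let i = k + test_size t; j = i + cmd_size a + 1
      in header_code k j t @ code i a @ goto (j + cmd_size b) # code j b)"
| "code k (While t a) =
     (let i = k + test_size t
      in header_code k (i + cmd_size a + 1) t @ code i a @ [goto k])"

lemma length_header_code [simp]: "length (header_code k no t) = test_size t"
  by (cases t) auto

lemma length_code [simp]: "length (code k c) = cmd_size c"
  by (induction c arbitrary: k) (auto simp: Let_def)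

definition placed :: "program \<Rightarrow> nat \<Rightarrow> program \<Rightarrow> bool" where
  "placed p k is \<longleftrightarrow> (\<forall>i < length is. k + i < length p \<and> p ! (k + i) = is ! i)"

lemma placed_Nil [simp]: "placed p k []"
  by (simp add: placed_def)

lemma placed_Cons [simp]: "placed p k (i # is) \<longleftrightarrow> k < length p \<and> p ! k = i \<and> placed p (Suc k) is"
  by (auto simp: placed_def All_less_Suc2)

lemma placed_append [simp]:
  "placed p k (is @ js) \<longleftrightarrow> placed p k is \<and> placed p (k + length is) js"
  by (induction "is" arbitrary: k) auto

lemma placed_self: "placed p 0 p"
  by (simp add: placed_def)

text \<open>That no configuration before the last is halted makes \<open>n\<close> a true number of
  steps, so that long paths refute early halting. \<open>Q\<close> is the exact set of queries, not
  a bound.\<close>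

definition path :: "(nat \<Rightarrow> bool) \<Rightarrow> (nat \<Rightarrow> nat \<Rightarrow> bool) \<Rightarrow> program \<Rightarrow> nat \<Rightarrow> config \<Rightarrow>
    (nat \<times> nat) set \<Rightarrow> config \<Rightarrow> bool" where
  "path X A p n c Q c' \<longleftrightarrow>
     (step X A p ^^ n) c = c' \<and> (\<forall>i<n. \<not> halted p ((step X A p ^^ i) c)) \<and>
     Q = {(e, m). \<exists>i<n. queries p ((step X A p ^^ i) c) e m}"

lemma path_refl: "path X A p 0 c {} c"
  by (simp add: path_def)

lemma path_step:
  assumes "\<not> halted p c" "step X A p c = c'" "Q = {(e, m). queries p c e m}"
  shows "path X A p (Suc 0) c Q c'"
  using assms by (simp add: path_def)

lemma ex_less_add_iff: "(\<exists>i < m + n. P i) \<longleftrightarrow> (\<exists>i < m. P i) \<or> (\<exists>i < n. P (i + m))" for m n :: nat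
proof
  assume "\<exists>i < m + n. P i"
  then obtain i where i: "i < m + n" "P i" by blast
  then show "(\<exists>i < m. P i) \<or> (\<exists>i < n. P (i + m))"
  proof (cases "i < m")
    case False
    then have "i - m < n \<and> P (i - m + m)" using i by auto
    then show ?thesis by blast
  qed blast
next
  assume "(\<exists>i < m. P i) \<or> (\<exists>i < n. P (i + m))"
  then show "\<exists>i < m + n. P i"
    by (metis add.commute nat_add_left_cancel_less trans_less_add1)
qed

lemma path_trans:
  assumes "path X A p n c Q c'" "path X A p n' c' Q' c''"
  shows "path X A p (n + n') c (Q \<union> Q') c''"
proof -
  have shift: "(step X A p ^^ (i + n)) c = (step X A p ^^ i) c'" for i
    using assms(1) by (simp add: path_def funpow_add)
  have "\<not> (\<exists>i < n + n'. halted p ((step X A p ^^ i) c))"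
    unfolding ex_less_add_iff shift using assms by (simp add: path_def)
  moreover have "Q \<union> Q' = {(e, m). \<exists>i < n + n'. queries p ((step X A p ^^ i) c) e m}"
    unfolding ex_less_add_iff shift using assms by (auto simp: path_def)
  ultimately show ?thesis
    using assms(2) shift[of n'] by (simp add: path_def add.commute)
qed

text \<open>Blanks listed explicitly are allowed on both sides, since \<open>put\<close> and
  \<open>move\<close> leave them behind.\<close>

definition tape_holds :: "tape \<Rightarrow> nat \<Rightarrow> bool" where
  "tape_holds t n \<longleftrightarrow>
     (\<exists>l. fst t = replicate n True @ l \<and> True \<notin> set l) \<and> True \<notin> set (snd t)"

definition tapes_hold :: "(nat \<Rightarrow> tape) \<Rightarrow> regs \<Rightarrow> bool" where
  "tapes_hold T s \<longleftrightarrow> (\<forall>r. tape_holds (T r) (s r))"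

lemma count_list_replicate_self: "count_list (replicate n x) x = n"
  by (induction n) auto

lemma tape_val_holds: "tape_holds t n \<Longrightarrow> tape_val t = n"
  by (cases t) (auto simp: tape_holds_def count_list_replicate_self)

lemma scanned_holds: "tape_holds t n \<Longrightarrow> \<not> scanned t"
  by (cases t) (auto simp: tape_holds_def neq_Nil_conv)

lemma tapes_hold_upd:
  "tapes_hold T s \<Longrightarrow> tape_holds t n \<Longrightarrow> tapes_hold (T(r := t)) (s(r := n))"
  by (simp add: tapes_hold_def)

lemma not_in_set_tl: "x \<notin> set xs \<Longrightarrow> x \<notin> set (tl xs)"
  by (cases xs) auto

lemma tape_holds_Suc: "tape_holds t n \<Longrightarrow> tape_holds (move Right (put True t)) (Suc n)"
  by (cases t) (auto simp: tape_holds_def not_in_set_tl)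

lemma tape_test_pos:
  assumes "tape_holds t (Suc n)"
  shows "scanned (move Left (put False t)) \<and>
    tape_holds (move Stay (put False (move Left (put False t)))) n"
  using assms by (cases t) (auto simp: tape_holds_def not_in_set_tl)

lemma tape_test_zero:
  assumes "tape_holds t 0"
  shows "\<not> scanned (move Left (put False t)) \<and>
    tape_holds (move Right (put False (move Left (put False t)))) 0"
  using assms by (cases t; cases "fst t") (auto simp: tape_holds_def not_in_set_tl)

lemma step_Act:
  assumes "q < length p" "p ! q = Act t a0 a1"
  shows "step X A p (q, T) =
    (let (b, d, q') = (if scanned (T t) then a1 else a0) in (q', T(t := move d (put b (T t)))))"
  using assms by (simp add: step_def halted_def)

lemma no_queries_Act: "p ! q = Act t a0 a1 \<Longrightarrow> {} = {(e, m). queries p (q, T) e m}"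
  by (simp add: queries_def)

lemma path_goto:
  assumes "k < length p" "p ! k = goto j" "tapes_hold T s"
  obtains T' where "path X A p (Suc 0) (k, T) {} (j, T')" "tapes_hold T' s"
proof -
  have T0: "tape_holds (T 0) (s 0)" using assms by (simp add: tapes_hold_def)
  have "step X A p (k, T) = (j, T(0 := move Stay (put False (T 0))))"
    using assms(1) assms(2)[unfolded goto_def] scanned_holds[OF T0] by (simp add: step_Act)
  moreover have "tape_holds (move Stay (put False (T 0))) (s 0)"
    using T0 by (cases "T 0") (auto simp: tape_holds_def not_in_set_tl)
  then have "tapes_hold (T(0 := move Stay (put False (T 0)))) s"
    using tapes_hold_upd[OF assms(3), of _ "s 0" 0] by simp
  ultimately show ?thesis
    using assms by (intro that path_step) (auto simp: halted_def queries_def goto_def)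
qed

lemma path_test:
  assumes "placed p k (header_code k no t)" "tapes_hold T s"
  obtains n T' where
    "path X A p (Suc n) (k, T) (test_queries s t)
       (if holds_test X A s t then k + test_size t else no, T')"
    "tapes_hold T' (after_test s t)"
proof (cases t)
  case (Pos r)
  define t1 where "t1 = move Left (put False (T r))"
  have Tr: "tape_holds (T r) (s r)" using assms by (simp add: tapes_hold_def)
  have p: "k < length p" "Suc k < length p"
    "p ! k = Act r (False, Left, Suc k) (True, Left, Suc k)"
    "p ! Suc k = Act r (False, Right, no) (False, Stay, Suc (Suc k))"
    using assms Pos by auto
  have 1: "path X A p (Suc 0) (k, T) {} (Suc k, T(r := t1))"
    using p scanned_holds[OF Tr] no_queries_Act[OF p(3)]
    by (intro path_step) (auto simp: step_Act t1_def halted_def)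
  show ?thesis
  proof (cases "s r")
    case 0
    have z: "\<not> scanned t1" "tape_holds (move Right (put False t1)) 0"
      using tape_test_zero Tr 0 unfolding t1_def by simp_all
    have "path X A p (Suc 0) (Suc k, T(r := t1)) {} (no, T(r := move Right (put False t1)))"
      using p z no_queries_Act[OF p(4)]
      by (intro path_step) (auto simp: step_Act halted_def)
    from path_trans[OF 1 this] show ?thesis
      using that[of "Suc 0"] Pos 0 tapes_hold_upd[OF assms(2) z(2), of r] by simp
  next
    case (Suc n)
    have z: "scanned t1" "tape_holds (move Stay (put False t1)) n"
      using tape_test_pos Tr Suc unfolding t1_def by simp_all
    have "path X A p (Suc 0) (Suc k, T(r := t1)) {}
        (Suc (Suc k), T(r := move Stay (put False t1)))"
      using p z no_queries_Act[OF p(4)]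
      by (intro path_step) (auto simp: step_Act halted_def)
    from path_trans[OF 1 this] show ?thesis
      using that[of "Suc 0"] Pos Suc tapes_hold_upd[OF assms(2) z(2), of r] by simp
  qed
next
  case (Orc u)
  have "tape_val (T u) = s u" using assms tape_val_holds by (simp add: tapes_hold_def)
  then have "path X A p (Suc 0) (k, T) {} (if X (s u) then Suc k else no, T)"
    using assms Orc by (intro path_step) (auto simp: step_def halted_def queries_def)
  then show ?thesis using that[of 0] Orc assms(2) by (simp cong: if_cong)
next
  case (Qry u v)
  have "tape_val (T u) = s u" "tape_val (T v) = s v"
    using assms tape_val_holds by (simp_all add: tapes_hold_def)
  then have "path X A p (Suc 0) (k, T) {(s u, s v)} (if A (s u) (s v) then Suc k else no, T)"
    using assms Qry by (intro path_step) (auto simp: step_def halted_def queries_def)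
  then show ?thesis using that[of 0] Qry assms(2) by (simp cong: if_cong)
qed

text \<open>The induction is on the evaluation rather than on the command, so that the later rounds
  of a loop form a subderivation; the query sets add up along \<open>path_trans\<close>.\<close>

lemma path_code:
  assumes "big_step X A c s Q s'" "placed p k (code k c)" "tapes_hold T s"
  shows "\<exists>n T'. path X A p n (k, T) Q (k + cmd_size c, T') \<and> tapes_hold T' s'"
  using assms
proof (induction arbitrary: k T)
  case (Skip s)
  then show ?case using path_refl by fastforce
next
  case (Inc r s)
  let ?T = "T(r := move Right (put True (T r)))"
  have p: "k < length p" "p ! k = Act r (True, Right, Suc k) (True, Right, Suc k)"
    using Inc by auto
  have "path X A p (Suc 0) (k, T) {} (Suc k, ?T)"
    using p no_queries_Act[OF p(2)] by (intro path_step) (auto simp: step_Act halted_def)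
  moreover have "tapes_hold ?T (s(r := Suc (s r)))"
    using Inc.prems(2) by (intro tapes_hold_upd tape_holds_Suc) (simp_all add: tapes_hold_def)
  moreover have "k + cmd_size (Inc r) = Suc k" by simp
  ultimately show ?case by metis
next
  case (Seq a s Q s' b Q' s'')
  obtain n T' where 1: "path X A p n (k, T) Q (k + cmd_size a, T')" "tapes_hold T' s'"
    using Seq.IH(1)[of k T] Seq.prems by auto
  obtain n' T'' where 2: "path X A p n' (k + cmd_size a, T') Q' (k + cmd_size a + cmd_size b, T'')"
      "tapes_hold T'' s''"
    using Seq.IH(2)[of "k + cmd_size a" T'] Seq.prems 1 by auto
  show ?case using path_trans[OF 1(1) 2(1)] 2(2) by (auto simp: add.assoc)
next
  case (Cond_yes s t a Q s' b)
  let ?i = "k + test_size t"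
  let ?j = "?i + cmd_size a + 1"
  have p: "placed p k (header_code k ?j t)" "placed p ?i (code ?i a)"
      "?i + cmd_size a < length p" "p ! (?i + cmd_size a) = goto (?j + cmd_size b)"
    using Cond_yes.prems(1) by (auto simp: Let_def)
  obtain n T1 where 1: "path X A p (Suc n) (k, T) (test_queries s t) (?i, T1)"
      "tapes_hold T1 (after_test s t)"
    using path_test[OF p(1) Cond_yes.prems(2), of X A] Cond_yes.hyps by auto
  obtain n' T2 where 2: "path X A p n' (?i, T1) Q (?i + cmd_size a, T2)" "tapes_hold T2 s'"
    using Cond_yes.IH[OF p(2) 1(2)] by auto
  obtain T3 where 3: "path X A p (Suc 0) (?i + cmd_size a, T2) {} (?j + cmd_size b, T3)"
      "tapes_hold T3 s'"
    using path_goto[OF p(3,4) 2(2)] by auto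
  have "path X A p (Suc n + n' + Suc 0) (k, T) (test_queries s t \<union> Q) (?j + cmd_size b, T3)"
    using path_trans[OF path_trans[OF 1(1) 2(1)] 3(1)] by simp
  moreover have "?j + cmd_size b = k + cmd_size (Cond t a b)" by simp
  ultimately show ?case using 3(2) by metis
next
  case (Cond_no s t b Q s' a)
  let ?i = "k + test_size t"
  let ?j = "?i + cmd_size a + 1"
  have p: "placed p k (header_code k ?j t)" "placed p ?j (code ?j b)"
    using Cond_no.prems(1) by (auto simp: Let_def)
  obtain n T1 where 1: "path X A p (Suc n) (k, T) (test_queries s t) (?j, T1)"
      "tapes_hold T1 (after_test s t)"
    using path_test[OF p(1) Cond_no.prems(2), of X A] Cond_no.hyps by auto
  obtain n' T2 where 2: "path X A p n' (?j, T1) Q (?j + cmd_size b, T2)" "tapes_hold T2 s'"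
    using Cond_no.IH[OF p(2) 1(2)] by auto
  have "?j + cmd_size b = k + cmd_size (Cond t a b)" by simp
  then show ?case using path_trans[OF 1(1) 2(1)] 2(2) by metis
next
  case (While_no s t a)
  let ?j = "k + test_size t + cmd_size a + 1"
  have p: "placed p k (header_code k ?j t)"
    using While_no.prems(1) by (auto simp: Let_def)
  obtain n T1 where 1: "path X A p (Suc n) (k, T) (test_queries s t) (?j, T1)"
      "tapes_hold T1 (after_test s t)"
    using path_test[OF p(1) While_no.prems(2), of X A] While_no.hyps by auto
  then show ?case by (auto simp: add.assoc)
next
  case (While_yes s t a Q s' Q' s'')
  let ?i = "k + test_size t"
  let ?j = "?i + cmd_size a + 1"
  have p: "placed p k (header_code k ?j t)" "placed p ?i (code ?i a)"
      "?i + cmd_size a < length p" "p ! (?i + cmd_size a) = goto k"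
    using While_yes.prems(1) by (auto simp: Let_def)
  obtain n T1 where 1: "path X A p (Suc n) (k, T) (test_queries s t) (?i, T1)"
      "tapes_hold T1 (after_test s t)"
    using path_test[OF p(1) While_yes.prems(2), of X A] While_yes.hyps by auto
  obtain n' T2 where 2: "path X A p n' (?i, T1) Q (?i + cmd_size a, T2)" "tapes_hold T2 s'"
    using While_yes.IH(1)[OF p(2) 1(2)] by auto
  obtain T3 where 3: "path X A p (Suc 0) (?i + cmd_size a, T2) {} (k, T3)" "tapes_hold T3 s'"
    using path_goto[OF p(3,4) 2(2)] by auto
  obtain n'' T4 where 4: "path X A p n'' (k, T3) Q' (k + cmd_size (While t a), T4)" "tapes_hold T4 s''"
    using While_yes.IH(2)[OF While_yes.prems(1) 3(2)] by auto
  have "path X A p (Suc n + n' + Suc 0 + n'') (k, T) (test_queries s t \<union> Q \<union> Q') (k + cmd_size (While t a), T4)"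
    using path_trans[OF path_trans[OF path_trans[OF 1(1) 2(1)] 3(1)] 4(1)] by simp
  then show ?case using 4(2) by metis
qed

section \<open>Primitive recursive functions\<close>

text \<open>Total correctness with the query set fixed to be empty: all arithmetic is silent, and
  the only \<open>Qry\<close> test is the one in the loop body built in
  \<open>machine_exists\<close>.\<close>

definition wp :: "(nat \<Rightarrow> bool) \<Rightarrow> (nat \<Rightarrow> nat \<Rightarrow> bool) \<Rightarrow> cmd \<Rightarrow> (regs \<Rightarrow> bool) \<Rightarrow> regs \<Rightarrow> bool" where
  "wp X A c P s \<longleftrightarrow> (\<exists>s'. big_step X A c s {} s' \<and> P s')"

lemma wp_Skip: "P s \<Longrightarrow> wp X A Skip P s"
  unfolding wp_def by (blast intro: big_step.Skip)

lemma wp_Inc: "P (s(r := Suc (s r))) \<Longrightarrow> wp X A (Inc r) P s"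
  unfolding wp_def by (blast intro: big_step.Inc)

lemma wp_Seq: "wp X A a (wp X A b P) s \<Longrightarrow> wp X A (a ;; b) P s"
  unfolding wp_def by (metis big_step.Seq sup_bot_left)

lemma wp_Cond_Pos:
  assumes "s r = 0 \<Longrightarrow> wp X A b P s" and "\<And>n. s r = Suc n \<Longrightarrow> wp X A a P (s(r := n))"
  shows "wp X A (Cond (Pos r) a b) P s"
proof (cases "s r")
  case 0
  then have "after_test s (Pos r) = s" by auto
  then show ?thesis
    using 0 assms(1) big_step.Cond_no[of X A s "Pos r" b "{}"] unfolding wp_def by fastforce
next
  case (Suc n)
  then show ?thesis
    using assms(2) big_step.Cond_yes[of X A s "Pos r" a "{}"] unfolding wp_def by fastforce
qed

text \<open>The test decrements \<open>r\<close> and the body must hand \<open>r\<close> back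
  unchanged, so the loop runs exactly \<open>s r\<close> rounds; the invariant is indexed by the
  number of rounds left.\<close>

lemma wp_While_Pos:
  assumes "I (s r) s"
    and "\<And>j s. I (Suc j) s \<Longrightarrow> s r = Suc j \<Longrightarrow> wp X A c (\<lambda>s'. s' r = j \<and> I j s') (s(r := j))"
    and "\<And>s. I 0 s \<Longrightarrow> s r = 0 \<Longrightarrow> P s"
  shows "wp X A (While (Pos r) c) P s"
proof -
  have "s r = n \<Longrightarrow> I n s \<Longrightarrow> wp X A (While (Pos r) c) P s" for n s
  proof (induction n arbitrary: s)
    case 0
    then have "after_test s (Pos r) = s" by auto
    with 0 assms(3) show ?case
      unfolding wp_def using big_step.While_no[of X A s "Pos r" c] by fastforce
  next
    case (Suc n)
    then obtain s1 where 1: "big_step X A c (s(r := n)) {} s1" "s1 r = n" "I n s1"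
      using assms(2) unfolding wp_def by blast
    then obtain s2 where "big_step X A (While (Pos r) c) s1 {} s2" "P s2"
      using Suc.IH unfolding wp_def by blast
    then show ?case
      using 1 Suc.prems big_step.While_yes[of X A s "Pos r" c "{}" s1 "{}" s2]
      unfolding wp_def by auto
  qed
  then show ?thesis using assms(1) by blast
qed

section \<open>Register programs for basic arithmetic\<close>

definition clear :: "nat \<Rightarrow> cmd" where
  "clear r = While (Pos r) Skip"

lemma wp_clear: "P (s(r := 0)) \<Longrightarrow> wp X A (clear r) P s"
  unfolding clear_def
  by (rule wp_While_Pos[where I = "\<lambda>_ s'. s'(r := 0) = s(r := 0)"])
    (auto intro!: wp_Skip simp: fun_upd_idem)

definition add_to :: "nat \<Rightarrow> nat \<Rightarrow> cmd" where
  "add_to r t = While (Pos r) (Inc t)"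

lemma wp_add_to:
  assumes "r \<noteq> t" "P (s(r := 0, t := s t + s r))"
  shows "wp X A (add_to r t) P s"
  unfolding add_to_def
proof (rule wp_While_Pos[where I = "\<lambda>j s'. s' = s(r := j, t := s t + s r - j) \<and> j \<le> s r"])
  fix j s'
  assume "s' = s(r := Suc j, t := s t + s r - Suc j) \<and> Suc j \<le> s r" "s' r = Suc j"
  then show "wp X A (Inc t)
      (\<lambda>s'. s' r = j \<and> s' = s(r := j, t := s t + s r - j) \<and> j \<le> s r) (s'(r := j))"
    using assms(1) by (intro wp_Inc) (auto intro!: ext simp: Suc_diff_le)
qed (use assms in auto)

text \<open>\<open>u\<close> is scratch: reading \<open>r\<close> empties it, so its value is moved
  to \<open>t\<close> and \<open>u\<close> at once and then restored from \<open>u\<close>.\<close>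

definition copy :: "nat \<Rightarrow> nat \<Rightarrow> nat \<Rightarrow> cmd" where
  "copy r t u = clear t ;; clear u ;; While (Pos r) (Inc t ;; Inc u) ;; add_to u r"

lemma wp_copy:
  assumes "r \<noteq> t" "r \<noteq> u" "t \<noteq> u" "P (s(t := s r, u := 0))"
  shows "wp X A (copy r t u) P s"
  unfolding copy_def
proof (intro wp_Seq wp_clear)
  let ?I = "\<lambda>j s'. s' = s(r := j, t := s r - j, u := s r - j) \<and> j \<le> s r"
  show "wp X A (While (Pos r) (Inc t ;; Inc u)) (wp X A (add_to u r) P) (s(t := 0, u := 0))"
  proof (rule wp_While_Pos[where I = ?I])
    fix j s'
    assume "?I (Suc j) s'" "s' r = Suc j"
    then show "wp X A (Inc t ;; Inc u) (\<lambda>s'. s' r = j \<and> ?I j s') (s'(r := j))"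
      using assms(1-3) by (intro wp_Seq wp_Inc) (auto intro!: ext simp: Suc_diff_le)
  next
    fix s' assume "?I 0 s'" "s' r = 0"
    then have s': "s' = s(r := 0, t := s r, u := s r)" by simp
    have "s'(u := 0, r := s' r + s' u) = s(t := s r, u := 0)"
      unfolding s' using assms(1-3) by auto
    then show "wp X A (add_to u r) P s'"
      using assms by (intro wp_add_to) auto
  qed (use assms in auto)
qed

definition pfst :: "nat \<Rightarrow> nat" where "pfst n = fst (prod_decode n)"
definition psnd :: "nat \<Rightarrow> nat" where "psnd n = snd (prod_decode n)"
abbreviation pair :: "nat \<Rightarrow> nat \<Rightarrow> nat" where "pair a b \<equiv> prod_encode (a, b)"

lemma pfst_pair [simp]: "pfst (pair a b) = a" and psnd_pair [simp]: "psnd (pair a b) = b"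
  by (simp_all add: pfst_def psnd_def)

lemma pair_eta [simp]: "pair (pfst n) (psnd n) = n"
  by (simp add: pfst_def psnd_def)

text \<open>The unary form of the primitive recursive functions: several arguments are packed into
  one by pairing, and pure iteration takes the place of recursion, which is recovered in
  \<open>pr_rec\<close>.\<close>

inductive pr :: "(nat \<Rightarrow> nat) \<Rightarrow> bool" where
  pr_zero: "pr (\<lambda>_. 0)"
| pr_suc: "pr Suc"
| pr_fst: "pr pfst"
| pr_snd: "pr psnd"
| pr_pair: "pr f \<Longrightarrow> pr g \<Longrightarrow> pr (\<lambda>x. pair (f x) (g x))"
| pr_comp: "pr f \<Longrightarrow> pr g \<Longrightarrow> pr (\<lambda>x. f (g x))"
| pr_iter: "pr f \<Longrightarrow> pr (\<lambda>x. (f ^^ psnd x) (pfst x))"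

text \<open>Registers above \<open>k\<close> are scratch and may be clobbered; a subroutine is
  placed at a higher \<open>k\<close> to protect the values in lower registers.\<close>

definition writes :: "nat \<Rightarrow> cmd \<Rightarrow> (regs \<Rightarrow> nat) \<Rightarrow> bool" where
  "writes k c F \<longleftrightarrow> (\<forall>X A s. wp X A c (\<lambda>s'. s' k = F s \<and> (\<forall>i<k. s' i = s i)) s)"

lemma wp_mono: "wp X A c P s \<Longrightarrow> (\<And>s'. P s' \<Longrightarrow> Q s') \<Longrightarrow> wp X A c Q s"
  unfolding wp_def by blast

lemma wp_writes:
  assumes "writes k c F" "\<And>s'. s' k = F s \<Longrightarrow> (\<And>i. i < k \<Longrightarrow> s' i = s i) \<Longrightarrow> P s'"
  shows "wp X A c P s"
  by (rule wp_mono[OF assms(1)[unfolded writes_def, rule_format]]) (use assms(2) in simp)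

lemma writesI:
  assumes "\<And>X A s. wp X A c (\<lambda>s'. s' k = F s \<and> (\<forall>i<k. s' i = s i)) s"
  shows "writes k c F"
  unfolding writes_def by (intro allI assms)

text \<open>Walks \<open>s k\<close> steps along the diagonals of Cantor's enumeration, starting
  from the pair of zeros: (a, b + 1) is followed by (a + 1, b), and (a, 0) by (0, a + 1).\<close>

definition decode :: "nat \<Rightarrow> cmd" where
  "decode k = clear (k + 1) ;; clear (k + 2) ;;
     While (Pos k) (Cond (Pos (k + 2)) (Inc (k + 1)) (Inc (k + 2) ;; add_to (k + 1) (k + 2)))"

lemma prod_encode_next:
  "pair 0 (Suc a) = Suc (pair a 0)" "pair (Suc a) b = Suc (pair a (Suc b))"
  by (simp_all add: prod_encode_def)

lemma wp_decode:
  assumes "\<And>s'. s' (k + 1) = pfst (s k) \<Longrightarrow> s' (k + 2) = psnd (s k) \<Longrightarrow>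
    (\<And>i. i < k \<Longrightarrow> s' i = s i) \<Longrightarrow> P s'"
  shows "wp X A (decode k) P s"
  unfolding decode_def
proof (intro wp_Seq wp_clear)
  let ?I = "\<lambda>j s'. pair (s' (k + 1)) (s' (k + 2)) + j = s k \<and> (\<forall>i<k. s' i = s i)"
  show "wp X A (While (Pos k) (Cond (Pos (k + 2)) (Inc (k + 1))
      (Inc (k + 2) ;; add_to (k + 1) (k + 2)))) P (s(k + 1 := 0, k + 2 := 0))"
  proof (rule wp_While_Pos[where I = ?I])
    fix j s' assume "?I (Suc j) s'" "s' k = Suc j"
    then show "wp X A (Cond (Pos (k + 2)) (Inc (k + 1)) (Inc (k + 2) ;; add_to (k + 1) (k + 2)))
        (\<lambda>s'. s' k = j \<and> ?I j s') (s'(k := j))"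
      by (intro wp_Cond_Pos wp_Seq wp_Inc wp_add_to)
        (auto simp: prod_encode_next)
  next
    fix s' assume "?I 0 s'" "s' k = 0"
    then have "s k = pair (s' (k + 1)) (s' (k + 2))" by simp
    then show "P s'" using \<open>?I 0 s'\<close> by (intro assms) simp_all
  qed (simp add: prod_encode_def)
qed

text \<open>Uses pair a b = triangle (a + b) + a with a in \<open>k + 2\<close> and b in
  \<open>k + 1\<close>; the loop adds a + b, a + b - 1, ..., 1 to a.\<close>

definition encode :: "nat \<Rightarrow> cmd" where
  "encode k = copy (k + 2) k (k + 3) ;; add_to (k + 2) (k + 1) ;;
     While (Pos (k + 1)) (Inc k ;; copy (k + 1) (k + 2) (k + 3) ;; add_to (k + 2) k)"

lemma wp_encode:
  assumes "\<And>s'. s' k = pair (s (k + 2)) (s (k + 1)) \<Longrightarrow> (\<And>i. i < k \<Longrightarrow> s' i = s i) \<Longrightarrow> P s'"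
  shows "wp X A (encode k) P s"
  unfolding encode_def
proof (rule wp_Seq, rule wp_copy)
  let ?I = "\<lambda>j s'. s' k + triangle j = pair (s (k + 2)) (s (k + 1)) \<and> (\<forall>i<k. s' i = s i)"
  let ?s = "s(k := s (k + 2), k + 3 := 0, k + 2 := 0, k + 1 := s (k + 1) + s (k + 2))"
  have "wp X A (While (Pos (k + 1)) (Inc k ;; copy (k + 1) (k + 2) (k + 3) ;; add_to (k + 2) k)) P ?s"
  proof (rule wp_While_Pos[where I = ?I])
    fix j s' assume "?I (Suc j) s'" "s' (k + 1) = Suc j"
    then show "wp X A (Inc k ;; copy (k + 1) (k + 2) (k + 3) ;; add_to (k + 2) k)
        (\<lambda>s'. s' (k + 1) = j \<and> ?I j s') (s'(k + 1 := j))"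
      by (intro wp_Seq wp_Inc wp_add_to wp_copy) auto
  qed (auto simp: prod_encode_def add.commute intro!: assms)
  then show "wp X A (add_to (k + 2) (k + 1) ;; While (Pos (k + 1))
      (Inc k ;; copy (k + 1) (k + 2) (k + 3) ;; add_to (k + 2) k)) P (s(k := s (k + 2), k + 3 := 0))"
    by (intro wp_Seq wp_add_to) (simp_all add: fun_upd_def)
qed auto

lemma writes_pr:
  assumes "pr f"
  shows "\<exists>c. writes k c (\<lambda>s. f (s k))"
  using assms
proof (induction arbitrary: k)
  case pr_zero
  have "writes k (clear k) (\<lambda>_. 0)"
    by (intro writesI wp_clear) auto
  then show ?case by blast
next
  case pr_suc
  have "writes k (Inc k) (\<lambda>s. Suc (s k))"
    by (intro writesI wp_Inc) auto
  then show ?case by blast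
next
  case pr_fst
  have "writes k (decode k ;; copy (k + 1) k (k + 2)) (\<lambda>s. pfst (s k))"
    by (intro writesI wp_Seq wp_decode wp_copy) auto
  then show ?case by blast
next
  case pr_snd
  have "writes k (decode k ;; copy (k + 2) k (k + 3)) (\<lambda>s. psnd (s k))"
    by (intro writesI wp_Seq wp_decode wp_copy) auto
  then show ?case by blast
next
  case (pr_pair f g)
  obtain a b where a: "writes (k + 2) a (\<lambda>s. f (s (k + 2)))"
    and b: "writes (k + 1) b (\<lambda>s. g (s (k + 1)))"
    using pr_pair by blast
  \<comment> \<open>\<open>b\<close> runs first because it may clobber \<open>k + 2\<close>;
    \<open>a\<close>, running at \<open>k + 2\<close>, leaves the value of g in \<open>k + 1\<close>
    alone.\<close>
  have "writes k (copy k (k + 1) (k + 2) ;; b ;; copy k (k + 2) (k + 3) ;; a ;; encode k)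
      (\<lambda>s. pair (f (s k)) (g (s k)))"
    by (intro writesI wp_Seq wp_copy wp_writes[OF a] wp_writes[OF b] wp_encode) auto
  then show ?case by blast
next
  case (pr_comp f g)
  obtain a b where a: "writes k a (\<lambda>s. f (s k))" and b: "writes k b (\<lambda>s. g (s k))"
    using pr_comp by blast
  have "writes k (b ;; a) (\<lambda>s. f (g (s k)))"
    by (intro writesI wp_Seq wp_writes[OF a] wp_writes[OF b]) auto
  then show ?case by blast
next
  case (pr_iter f)
  obtain a where a: "writes (k + 2) a (\<lambda>s. f (s (k + 2)))"
    using pr_iter by blast
  \<comment> \<open>The counter goes to \<open>k + 1\<close>, below the current value in
    \<open>k + 2\<close>, so that \<open>a\<close> cannot disturb it; register \<open>k\<close>
    serves to exchange the two components.\<close>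
  have "writes k (decode k ;; copy (k + 1) k (k + 3) ;; copy (k + 2) (k + 1) (k + 3) ;;
      copy k (k + 2) (k + 3) ;; While (Pos (k + 1)) a ;; copy (k + 2) k (k + 3))
      (\<lambda>s. (f ^^ psnd (s k)) (pfst (s k)))"
  proof (intro writesI wp_Seq wp_decode wp_copy)
    fix X A s s'
    assume s': "s' (k + 1) = pfst (s k)" "s' (k + 2) = psnd (s k)" "\<And>i. i < k \<Longrightarrow> s' i = s i"
    let ?P = "\<lambda>s'. s' k = (f ^^ psnd (s k)) (pfst (s k)) \<and> (\<forall>i<k. s' i = s i)"
    let ?s = "s'(k := s' (k + 1), k + 3 := 0)"
    let ?s = "?s(k + 1 := ?s (k + 2), k + 3 := 0)"
    let ?s = "?s(k + 2 := ?s k, k + 3 := 0)"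
    let ?I = "\<lambda>j s'. (f ^^ j) (s' (k + 2)) = (f ^^ psnd (s k)) (pfst (s k)) \<and> (\<forall>i<k. s' i = s i)"
    show "wp X A (While (Pos (k + 1)) a) (wp X A (copy (k + 2) k (k + 3)) ?P) ?s"
    proof (rule wp_While_Pos[where I = ?I])
      fix j s' assume "?I (Suc j) s'" "s' (k + 1) = Suc j"
      then show "wp X A a (\<lambda>s'. s' (k + 1) = j \<and> ?I j s') (s'(k + 1 := j))"
        by (intro wp_writes[OF a]) (auto simp: funpow_swap1)
    qed (use s' in \<open>auto intro!: wp_copy\<close>)
  qed auto
  then show ?case by blast
qed

section \<open>Feedback computations driven by primitive recursive functions\<close>

text \<open>A computation, that is a program and its input, is coded by the pair of the two.\<close>

definition defined :: "(nat \<Rightarrow> bool) \<Rightarrow> nat \<Rightarrow> bool" where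
  "defined X z \<longleftrightarrow> (\<exists>r. ((pfst z, psnd z, X), r) \<in> I_infty)"

definition converges :: "(nat \<Rightarrow> bool) \<Rightarrow> nat \<Rightarrow> bool" where
  "converges X z \<longleftrightarrow> fb_conv (pfst z) X (psnd z)"

text \<open>A total answer function: undefined computations are answered like divergent ones, so
  that every program has a determinate run even where it is undefined.\<close>

definition answer :: "(nat \<Rightarrow> bool) \<Rightarrow> nat \<Rightarrow> nat \<Rightarrow> bool" where
  "answer X e m \<longleftrightarrow> converges X (pair e m)"

definition asks :: "(nat \<Rightarrow> bool) \<Rightarrow> nat \<Rightarrow> nat \<Rightarrow> bool" where
  "asks X z q \<longleftrightarrow>
     (\<exists>n. queries (prog (pfst z)) (run X (answer X) (pfst z) (psnd z) n) (pfst q) (psnd q))"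

lemma defined_pair: "defined X (pair e m) \<longleftrightarrow> (\<exists>r. ((e, m, X), r) \<in> I_infty)"
  by (simp add: defined_def)

lemma answer_is_conv:
  assumes "((e, m, X), r) \<in> I_infty"
  shows "answer X e m \<longleftrightarrow> is_conv r"
proof (cases r)
  case (Converges k)
  then show ?thesis using assms by (auto simp: answer_def converges_def fb_conv_def fb_conv_to_def)
next
  case Diverges
  then have "((e, m, X), Converges k) \<notin> I_infty" for k
    using assms single_valuedD[OF single_valued_I_infty] by blast
  then show ?thesis using Diverges by (simp add: answer_def converges_def fb_conv_def fb_conv_to_def)
qed

text \<open>Any answers that are correct at the queries actually made produce the same run as
  \<open>answer X\<close>, so this one choice can replace the existential quantifier over answers in
  \<open>fb_op\<close>.\<close>

lemma I_infty_iff: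
  "((e, m, X), r) \<in> I_infty \<longleftrightarrow>
     (\<forall>n e' m'. queries (prog e) (run X (answer X) e m n) e' m' \<longrightarrow> defined X (pair e' m')) \<and>
     has_outcome X (answer X) e m r"
proof
  assume "((e, m, X), r) \<in> I_infty"
  then have "((e, m, X), r) \<in> fb_op I_infty"
    by (subst (asm) I_infty_unfold)
  then obtain B where B: "\<forall>n e' m'. queries (prog e) (run X B e m n) e' m' \<longrightarrow>
      (\<exists>r'. ((e', m', X), r') \<in> I_infty \<and> B e' m' = is_conv r')"
    and r: "has_outcome X B e m r"
    unfolding fb_op_def by auto
  have run: "run X (answer X) e m n = run X B e m n" for n
    by (rule run_cong) (use B answer_is_conv in metis)
  have "has_outcome X (answer X) e m r"
    using r by (cases r) (simp_all add: run)
  then show "(\<forall>n e' m'. queries (prog e) (run X (answer X) e m n) e' m' \<longrightarrow> defined X (pair e' m')) \<and>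
      has_outcome X (answer X) e m r"
    using B unfolding run defined_pair by blast
next
  assume *: "(\<forall>n e' m'. queries (prog e) (run X (answer X) e m n) e' m' \<longrightarrow> defined X (pair e' m')) \<and>
      has_outcome X (answer X) e m r"
  moreover have "\<exists>r'. ((e', m', X), r') \<in> I_infty \<and> answer X e' m' = is_conv r'"
    if "defined X (pair e' m')" for e' m'
    using that answer_is_conv unfolding defined_pair by blast
  ultimately have "((e, m, X), r) \<in> fb_op I_infty"
    unfolding fb_op_def by (auto intro!: exI[of _ "answer X"])
  then show "((e, m, X), r) \<in> I_infty"
    by (subst I_infty_unfold)
qed

lemma has_outcome_exists: "\<exists>r. has_outcome X A e m r"
  by (metis has_outcome.simps)

text \<open>The run under \<open>answer X\<close> always either halts or goes on forever, so an
  undefined query is the only possible cause of undefinedness.\<close>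

lemma defined_iff: "defined X z \<longleftrightarrow> (\<forall>q. asks X z q \<longrightarrow> defined X q)"
proof -
  have "\<exists>r. has_outcome X (answer X) (pfst z) (psnd z) r"
    by (rule has_outcome_exists)
  then have "defined X z \<longleftrightarrow> (\<forall>n e' m'. queries (prog (pfst z))
      (run X (answer X) (pfst z) (psnd z) n) e' m' \<longrightarrow> defined X (pair e' m'))"
    unfolding defined_def[of X z] I_infty_iff by simp
  then show ?thesis unfolding asks_def by (metis pair_eta pfst_pair psnd_pair)
qed

lemma fb_conv_to_iff:
  "fb_conv_to e X m k \<longleftrightarrow> defined X (pair e m) \<and> has_outcome X (answer X) e m (Converges k)"
  unfolding fb_conv_to_def defined_pair using I_infty_iff by blast

lemma converges_defined: "converges X z \<Longrightarrow> defined X z"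
  by (auto simp: converges_def defined_def fb_conv_def fb_conv_to_def)

text \<open>On the defined computations \<open>asks\<close> is well-founded; this is induction over
  the least fixed point with the oracle held fixed.\<close>

lemma defined_induct [consumes 1, case_names defined]:
  assumes "defined X z"
    and step: "\<And>z. defined X z \<Longrightarrow> (\<And>q. asks X z q \<Longrightarrow> P q) \<Longrightarrow> P z"
  shows "P z"
proof -
  define D :: computations where "D = {((e, m, Y), r) | e m Y r. Y = X \<longrightarrow> P (pair e m)}"
  have "fb_op (I_infty \<inter> D) \<subseteq> D"
  proof
    fix z assume z: "z \<in> fb_op (I_infty \<inter> D)"
    then have "z \<in> fb_op I_infty"
      using mono_fb_op by (meson Int_lower1 monoD subsetD)
    then have zI: "z \<in> I_infty"
      by (subst I_infty_unfold)
    from z obtain e m Y r A where z': "z = ((e, m, Y), r)"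
      and A: "\<forall>n e' m'. queries (prog e) (run Y A e m n) e' m' \<longrightarrow>
        (\<exists>r'. ((e', m', Y), r') \<in> I_infty \<inter> D \<and> A e' m' = is_conv r')"
      unfolding fb_op_def by (elim CollectE exE conjE) (rule that)
    have "P (pair e m)" if "Y = X"
    proof (rule step)
      show "defined X (pair e m)" using zI z' that by (auto simp: defined_def)
      fix q assume "asks X (pair e m) q"
      then obtain n where n: "queries (prog e) (run X (answer X) e m n) (pfst q) (psnd q)"
        by (auto simp: asks_def)
      have eq: "run X (answer X) e m n = run X A e m n"
        by (rule run_cong) (use A that answer_is_conv in \<open>metis IntD1\<close>)
      have "\<exists>r'. ((pfst q, psnd q, X), r') \<in> D" using A n that unfolding eq by blast
      then show "P q" by (simp add: D_def)
    qed
    then show "z \<in> D" by (simp add: D_def z')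
  qed
  then have "I_infty \<subseteq> D"
    unfolding I_infty_def by (rule lfp_induct[OF mono_fb_op])
  then show ?thesis using assms(1) by (auto simp: defined_def D_def)
qed

text \<open>
  Every step of a machine consults the oracle and issues a feedback query; where it has nothing to
  ask, it queries the computation 0, which is the empty program and converges.
\<close>

record machine =
  m_init :: "nat \<Rightarrow> nat"
  m_live :: "nat \<Rightarrow> nat"
  m_orc :: "nat \<Rightarrow> nat"
  m_query :: "nat \<Rightarrow> nat"
  m_next :: "nat \<Rightarrow> nat \<Rightarrow> nat \<Rightarrow> nat"
  m_out :: "nat \<Rightarrow> nat"

abbreviation "m_prog M s \<equiv> pfst (m_query M s)"
abbreviation "m_arg M s \<equiv> psnd (m_query M s)"

definition m_step :: "machine \<Rightarrow> (nat \<Rightarrow> bool) \<Rightarrow> (nat \<Rightarrow> nat \<Rightarrow> bool) \<Rightarrow> nat \<Rightarrow> nat" where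
  "m_step M X A s =
     (if m_live M s = 0 then s
      else m_next M (of_bool (X (m_orc M s))) (of_bool (A (m_prog M s) (m_arg M s))) s)"

definition m_state :: "machine \<Rightarrow> (nat \<Rightarrow> bool) \<Rightarrow> (nat \<Rightarrow> nat \<Rightarrow> bool) \<Rightarrow> nat \<Rightarrow> nat \<Rightarrow> nat" where
  "m_state M X A m n = (m_step M X A ^^ n) (m_init M m)"

lemma m_state_simps [simp]:
  "m_state M X A m 0 = m_init M m"
  "m_state M X A m (Suc n) = m_step M X A (m_state M X A m n)"
  by (simp_all add: m_state_def)

lemma m_state_dead:
  assumes "m_live M (m_state M X A m i) = 0" and "i \<le> j"
  shows "m_state M X A m j = m_state M X A m i"
  using assms(2) by (induction j rule: dec_induct) (simp_all add: assms(1) m_step_def)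

definition m_queries :: "machine \<Rightarrow> (nat \<Rightarrow> bool) \<Rightarrow> (nat \<Rightarrow> nat \<Rightarrow> bool) \<Rightarrow> nat \<Rightarrow> nat \<Rightarrow> (nat \<times> nat) set" where
  "m_queries M X A m n =
     {(m_prog M s, m_arg M s) | s i. i < n \<and> s = m_state M X A m i \<and> m_live M s \<noteq> 0}"

text \<open>Order and multiplicity of the queries are forgotten: definedness depends only on the set
  of queries, and convergence only on the results.\<close>

definition implements :: "nat \<Rightarrow> machine \<Rightarrow> bool" where
  "implements e M \<longleftrightarrow> (\<forall>X A m.
     (\<forall>e' m'. (\<exists>n. queries (prog e) (run X A e m n) e' m') \<longleftrightarrow> (\<exists>n. (e', m') \<in> m_queries M X A m n)) \<and>
     (\<forall>k. has_outcome X A e m (Converges k) \<longleftrightarrow>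
        (\<exists>n. m_live M (m_state M X A m n) = 0 \<and> m_out M (m_state M X A m n) = k)))"

text \<open>In the clause for \<open>m_next\<close> the arguments are packed as the loop body leaves
  them in register 0: query bit, oracle bit, state.\<close>

definition pr_machine :: "machine \<Rightarrow> bool" where
  "pr_machine M \<longleftrightarrow> pr (m_init M) \<and> pr (m_live M) \<and> pr (m_orc M) \<and> pr (m_query M) \<and>
     pr (\<lambda>x. m_next M (pfst (psnd x)) (pfst x) (psnd (psnd x))) \<and> pr (m_out M)"

section \<open>Realising machines by Turing machine programs\<close>

lemma pr_id: "pr (\<lambda>x. x)"
  using pr_pair[OF pr_fst pr_snd] by simp

lemma wp_Cond_Orc:
  assumes "X (s t) \<Longrightarrow> wp X A a P s" and "\<not> X (s t) \<Longrightarrow> wp X A b P s"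
  shows "wp X A (Cond (Orc t) a b) P s"
proof (cases "X (s t)")
  case True
  then show ?thesis
    using assms(1) big_step.Cond_yes[of X A s "Orc t" a "{}"] unfolding wp_def by fastforce
next
  case False
  then show ?thesis
    using assms(2) big_step.Cond_no[of X A s "Orc t" b "{}"] unfolding wp_def by fastforce
qed

lemma wp_run:
  assumes "wp X A c P s" "placed p k (code k c)" "tapes_hold T s"
  obtains n T' s' where "path X A p n (k, T) {} (k + cmd_size c, T')" "tapes_hold T' s'" "P s'"
  using assms path_code unfolding wp_def by metis

lemma tape_val_init: "tapes_hold (snd (init m)) (\<lambda>r. if r = 0 then m else 0)"
  by (auto simp: init_def tapes_hold_def tape_holds_def)

text \<open>The state is kept in register 0 and its live flag in register 1; each round of a single
  \<open>While\<close> loop computes the query, asks it and updates the state. Only this loop can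
  run forever, everything around it being primitive recursive.\<close>

lemma machine_exists:
  assumes "pr_machine M"
  shows "\<exists>e. implements e M"
proof -
  have pr1: "pr (\<lambda>x. pair (Suc 0) x)" "pr (\<lambda>x. pair 0 x)"
    by (intro pr_pair pr_zero pr_id pr_comp[OF pr_suc pr_zero])+
  note M = assms[unfolded pr_machine_def]
  obtain c_init where c_init: "writes 0 c_init (\<lambda>s. m_init M (s 0))"
    using writes_pr M by blast
  obtain c_live where c_live: "writes 1 c_live (\<lambda>s. m_live M (s 1))"
    using writes_pr M by blast
  obtain c_orc where c_orc: "writes 1 c_orc (\<lambda>s. m_orc M (s 1))"
    using writes_pr M by blast
  \<comment> \<open>\<open>psnd\<close> strips the oracle bit, which precedes the state by the time
    the query is computed.\<close>
  obtain c_prog where c_prog: "writes 1 c_prog (\<lambda>s. m_prog M (psnd (s 1)))"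
    using writes_pr[OF pr_comp[OF pr_fst pr_comp[OF _ pr_snd]]] M by blast
  obtain c_arg where c_arg: "writes 2 c_arg (\<lambda>s. m_arg M (psnd (s 2)))"
    using writes_pr[OF pr_comp[OF pr_snd pr_comp[OF _ pr_snd]]] M by blast
  obtain c_next where c_next:
    "writes 0 c_next (\<lambda>s. m_next M (pfst (psnd (s 0))) (pfst (s 0)) (psnd (psnd (s 0))))"
    using writes_pr[of "\<lambda>x. m_next M (pfst (psnd x)) (pfst x) (psnd (psnd x))" 0] M by blast
  obtain c_out where c_out: "writes 0 c_out (\<lambda>s. m_out M (s 0))"
    using writes_pr M by blast
  obtain c_yes c_no where c_yes: "writes 0 c_yes (\<lambda>s. pair (Suc 0) (s 0))"
    and c_no: "writes 0 c_no (\<lambda>s. pair 0 (s 0))"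
    using writes_pr[OF pr1(1)] writes_pr[OF pr1(2)] by blast
  define test_live where "test_live = copy 0 1 2 ;; c_live"
  define body1 where "body1 = copy 0 1 2 ;; c_orc ;; Cond (Orc 1) c_yes c_no ;;
      copy 0 1 2 ;; c_prog ;; copy 0 2 3 ;; c_arg"
  define body2 where "body2 = c_next ;; test_live"
  define body where "body = body1 ;; Cond (Qry 1 2) c_yes c_no ;; body2"
  define start where "start = c_init ;; test_live"
  define loop where "loop = While (Pos 1) body"
  define p where "p = code 0 (start ;; loop ;; c_out)"
  obtain e where e: "prog e = p" using surj_prog by (metis surjD)
  let ?h = "cmd_size start"
  let ?end = "?h + cmd_size loop"
  have p: "placed p 0 (code 0 start)" "placed p ?h (code ?h loop)" "placed p ?end (code ?end c_out)"
    using placed_self[of p] by (simp_all add: p_def)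
  have len: "length p = ?end + cmd_size c_out" by (simp add: p_def)
  have live: "wp X A test_live (\<lambda>s'. s' 0 = s 0 \<and> s' 1 = m_live M (s 0)) s" for X A s
    unfolding test_live_def by (intro wp_Seq wp_copy wp_writes[OF c_live]) auto
  have body: "\<exists>s'. big_step X A body s {(m_prog M (s 0), m_arg M (s 0))} s' \<and>
      s' 0 = m_step M X A (s 0) \<and> s' 1 = m_live M (s' 0)"
    if "m_live M (s 0) \<noteq> 0" for X A s
  proof -
    let ?b = "of_bool (X (m_orc M (s 0))) :: nat"
    let ?q = "A (m_prog M (s 0)) (m_arg M (s 0))"
    have "wp X A body1 (\<lambda>s'. s' 0 = pair ?b (s 0) \<and> s' 1 = m_prog M (s 0) \<and> s' 2 = m_arg M (s 0)) s"
      unfolding body1_def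
      by (intro wp_Seq wp_copy wp_writes[OF c_orc] wp_Cond_Orc wp_writes[OF c_yes] wp_writes[OF c_no]
          wp_writes[OF c_prog] wp_writes[OF c_arg]) auto
    then obtain s1 where s1: "big_step X A body1 s {} s1" "s1 0 = pair ?b (s 0)"
        "s1 1 = m_prog M (s 0)" "s1 2 = m_arg M (s 0)"
      unfolding wp_def by blast
    obtain s2 where s2: "big_step X A (if ?q then c_yes else c_no) s1 {} s2"
        "s2 0 = pair (of_bool ?q) (s1 0)"
      using c_yes c_no unfolding writes_def wp_def by (cases ?q) force+
    have 2: "big_step X A (Cond (Qry 1 2) c_yes c_no) s1 {(m_prog M (s 0), m_arg M (s 0))} s2"
      using big_step.Cond_yes[of X A s1 "Qry 1 2" c_yes "{}" s2]
        big_step.Cond_no[of X A s1 "Qry 1 2" c_no "{}" s2] s1 s2(1)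
      by (cases ?q) auto
    have "wp X A body2 (\<lambda>s'. s' 0 = m_next M ?b (of_bool ?q) (s 0) \<and> s' 1 = m_live M (s' 0)) s2"
      unfolding body2_def
      by (intro wp_Seq wp_writes[OF c_next] wp_mono[OF live]) (auto simp: s2 s1)
    then obtain s3 where s3: "big_step X A body2 s2 {} s3"
        "s3 0 = m_next M ?b (of_bool ?q) (s 0)" "s3 1 = m_live M (s3 0)"
      unfolding wp_def by blast
    have "big_step X A body s {(m_prog M (s 0), m_arg M (s 0))} s3"
      using big_step.Seq[OF s1(1) big_step.Seq[OF 2 s3(1)]] unfolding body_def by simp
    then show ?thesis using s3 that unfolding m_step_def by auto
  qed
  have "implements e M"
    unfolding implements_def
  proof (intro allI)
    fix X A m
    let ?s = "m_state M X A m"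
    \<comment> \<open>The bound \<open>n \<le> N\<close> rules out halting when the machine stays
      live forever: the paths back to the loop head get arbitrarily long.\<close>
    have path: "\<exists>N T s. n \<le> N \<and> path X A p N (init m) (m_queries M X A m n) (?h, T) \<and>
        tapes_hold T s \<and> s 0 = ?s n \<and> s 1 = m_live M (s 0)"
      if "\<forall>i<n. m_live M (?s i) \<noteq> 0" for n
      using that
    proof (induction n)
      case 0
      have W: "wp X A start (\<lambda>s'. s' 0 = m_init M m \<and> s' 1 = m_live M (s' 0)) (\<lambda>r. if r = 0 then m else 0)"
        unfolding start_def
        by (intro wp_Seq wp_writes[OF c_init] wp_mono[OF live]) auto
      obtain N T s where "path X A p N (0, snd (init m)) {} (0 + ?h, T)" "tapes_hold T s"
          "s 0 = m_init M m \<and> s 1 = m_live M (s 0)"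
        by (rule wp_run[OF W p(1) tape_val_init])
      moreover have "(0, snd (init m)) = init m" by (simp add: init_def)
      moreover have "m_queries M X A m 0 = {}" by (simp add: m_queries_def)
      ultimately show ?case by (intro exI[of _ N] exI[of _ T] exI[of _ s]) simp
    next
      case (Suc n)
      then obtain N T s where 0: "n \<le> N" "path X A p N (init m) (m_queries M X A m n) (?h, T)"
        "tapes_hold T s" "s 0 = ?s n" "s 1 = m_live M (s 0)"
        by auto
      have s: "m_live M (s 0) \<noteq> 0" using 0 Suc.prems by simp
      let ?k = "?h + 2"
      have q: "placed p ?h (header_code ?h (?k + cmd_size body + 1) (Pos 1))"
        "placed p ?k (code ?k body)" "?k + cmd_size body < length p"
        "p ! (?k + cmd_size body) = goto ?h"
        using p(2) by (auto simp: Let_def loop_def)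
      obtain N1 T1 where 1: "path X A p (Suc N1) (?h, T) {} (?k, T1)" "tapes_hold T1 (s(1 := s 1 - 1))"
        using path_test[OF q(1) 0(3), of X A] 0(5) s by auto
      \<comment> \<open>The test has decremented the live flag. This does no harm, as the effect of
        the body depends on register 0 only and the flag is recomputed.\<close>
      let ?t = "s(1 := s 1 - 1)"
      obtain s' where s': "big_step X A body ?t {(m_prog M (s 0), m_arg M (s 0))} s'"
          "s' 0 = m_step M X A (s 0)" "s' 1 = m_live M (s' 0)"
        using body[of ?t X A] s by auto
      obtain N2 T2 where 2: "path X A p N2 (?k, T1) {(m_prog M (s 0), m_arg M (s 0))} (?k + cmd_size body, T2)"
          "tapes_hold T2 s'"
        using path_code[OF s'(1) q(2) 1(2)] by blast
      obtain T3 where 3: "path X A p (Suc 0) (?k + cmd_size body, T2) {} (?h, T3)" "tapes_hold T3 s'"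
        using path_goto[OF q(3,4) 2(2)] by blast
      have "m_queries M X A m (Suc n) = m_queries M X A m n \<union> ({} \<union> ({(m_prog M (s 0), m_arg M (s 0))} \<union> {}))"
        using s 0(4) by (auto simp: m_queries_def less_Suc_eq)
      then have "path X A p (N + (Suc N1 + (N2 + Suc 0))) (init m) (m_queries M X A m (Suc n)) (?h, T3)"
        using path_trans[OF 0(2) path_trans[OF 1(1) path_trans[OF 2(1) 3(1)]]] by simp
      moreover have "Suc n \<le> N + (Suc N1 + (N2 + Suc 0))" using 0(1) by simp
      ultimately show ?case using 3(2) s'(2,3) 0(4) by (metis m_state_simps(2))
    qed
    have run: "run X A e m i = (step X A p ^^ i) (init m)" for i
      by (simp add: run_def e)
    show "(\<forall>e' m'. (\<exists>n. queries (prog e) (run X A e m n) e' m') \<longleftrightarrow> (\<exists>n. (e', m') \<in> m_queries M X A m n)) \<and>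
      (\<forall>k. has_outcome X A e m (Converges k) \<longleftrightarrow>
        (\<exists>n. m_live M (?s n) = 0 \<and> m_out M (?s n) = k))"
    proof (cases "\<exists>n. m_live M (?s n) = 0")
      case True
      define n where "n = (LEAST n. m_live M (?s n) = 0)"
      have n: "m_live M (?s n) = 0" "\<forall>i<n. m_live M (?s i) \<noteq> 0"
        using True not_less_Least unfolding n_def by (metis (mono_tags, lifting) LeastI_ex)+
      obtain N T s where 0: "path X A p N (init m) (m_queries M X A m n) (?h, T)"
        "tapes_hold T s" "s 0 = ?s n" "s 1 = m_live M (s 0)"
        using path[OF n(2)] by auto
      have q: "placed p ?h (header_code ?h ?end (Pos 1))"
        using p(2) by (auto simp: Let_def loop_def add.assoc)
      obtain N1 T1 where 1: "path X A p (Suc N1) (?h, T) {} (?end, T1)" "tapes_hold T1 (s(1 := s 1 - 1))"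
        using path_test[OF q 0(2), of X A] 0 n(1) by auto
      have W: "wp X A c_out (\<lambda>s'. s' 0 = m_out M (?s n)) (s(1 := s 1 - 1))"
        using 0(3) by (intro wp_writes[OF c_out]) auto
      obtain N2 T2 s2 where 2: "path X A p N2 (?end, T1) {} (?end + cmd_size c_out, T2)"
          "tapes_hold T2 s2" "s2 0 = m_out M (?s n)"
        by (rule wp_run[OF W p(3) 1(2)])
      have P: "path X A p (N + (Suc N1 + N2)) (init m) (m_queries M X A m n) (length p, T2)"
        using path_trans[OF 0(1) path_trans[OF 1(1) 2(1)]] len by simp
      let ?N = "N + (Suc N1 + N2)"
      have fin: "run X A e m ?N = (length p, T2)" using P by (simp add: path_def run)
      have halt: "halted (prog e) (run X A e m ?N)" unfolding fin halted_def by (simp add: e)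
      have "tape_holds (T2 0) (m_out M (?s n))"
        using 2(2,3) unfolding tapes_hold_def by metis
      then have "result (run X A e m ?N) = m_out M (?s n)"
        unfolding fin result_def by (simp add: tape_val_holds)
      then have out: "has_outcome X A e m (Converges (m_out M (?s n)))" using halt by auto
      have after: "\<not> queries (prog e) (run X A e m i) e' m'" if "?N \<le> i" for i e' m'
        using run_halted[OF halt that] halt by (simp add: queries_def)
      have dead: "?s i = ?s n" if "n \<le> i" for i
        using m_state_dead n(1) that by blast
      have "m_queries M X A m i \<subseteq> m_queries M X A m n" for i
      proof -
        have "j < n" if "m_live M (?s j) \<noteq> 0" for j
          using dead[of j] n(1) that by (metis not_less)
        then show ?thesis unfolding m_queries_def by blast
      qed
      moreover have "(\<exists>i. queries (prog e) (run X A e m i) e' m') \<longleftrightarrow> (e', m') \<in> m_queries M X A m n" for e' m'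
      proof -
        have "(e', m') \<in> m_queries M X A m n \<longleftrightarrow> (\<exists>i<?N. queries (prog e) (run X A e m i) e' m')"
          using P unfolding path_def run e by auto
        then show ?thesis using after by (metis not_less)
      qed
      moreover have "has_outcome X A e m (Converges k) \<longleftrightarrow> m_out M (?s n) = k" for k
        using out has_outcome_unique by blast
      moreover have "(\<exists>i. m_live M (?s i) = 0 \<and> m_out M (?s i) = k) \<longleftrightarrow> m_out M (?s n) = k" for k
        using n dead by (metis not_less)
      ultimately show ?thesis by blast
    next
      case False
      have P: "\<exists>N\<ge>n. \<exists>T. path X A p N (init m) (m_queries M X A m n) (?h, T)" for n
        using path[of n] False by metis
      have "\<not> halted p (run X A e m i)" for i
        using P[of "Suc i"] unfolding path_def run by (metis Suc_le_lessD)
      then have "\<not> has_outcome X A e m (Converges k)" for k by (simp add: e)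
      moreover have "(\<exists>n. queries (prog e) (run X A e m n) e' m') \<longleftrightarrow> (\<exists>n. (e', m') \<in> m_queries M X A m n)" for e' m'
      proof
        assume "\<exists>n. queries (prog e) (run X A e m n) e' m'"
        then obtain i where i: "queries p (run X A e m i) e' m'" by (auto simp: e)
        obtain N T where "Suc i \<le> N" "path X A p N (init m) (m_queries M X A m (Suc i)) (?h, T)"
          using P by blast
        then show "\<exists>n. (e', m') \<in> m_queries M X A m n"
          using i unfolding path_def run by (metis (mono_tags, lifting) Suc_le_lessD case_prodI mem_Collect_eq)
      next
        assume "\<exists>n. (e', m') \<in> m_queries M X A m n"
        then obtain n where n: "(e', m') \<in> m_queries M X A m n" by blast
        obtain N T where "path X A p N (init m) (m_queries M X A m n) (?h, T)"
          using P by blast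
        then show "\<exists>n. queries (prog e) (run X A e m n) e' m'"
          using n unfolding path_def run e by auto
      qed
      ultimately show ?thesis using False by blast
    qed
  qed
  then show ?thesis by blast
qed

lemma machine_asks_iff:
  assumes "implements e M"
  shows "asks X (pair e m) q \<longleftrightarrow>
    (\<exists>n. m_live M (m_state M X (answer X) m n) \<noteq> 0 \<and> q = m_query M (m_state M X (answer X) m n))"
proof -
  have "asks X (pair e m) q \<longleftrightarrow> (\<exists>n. (pfst q, psnd q) \<in> m_queries M X (answer X) m n)"
    using assms unfolding implements_def asks_def by simp
  also have "\<dots> \<longleftrightarrow> (\<exists>n. m_live M (m_state M X (answer X) m n) \<noteq> 0 \<and>
      q = m_query M (m_state M X (answer X) m n))"
    unfolding m_queries_def by (auto simp flip: pair_eta) (metis lessI pair_eta)+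
  finally show ?thesis .
qed

lemma machine_defined_iff:
  assumes "implements e M"
  shows "defined X (pair e m) \<longleftrightarrow>
    (\<forall>n. m_live M (m_state M X (answer X) m n) \<noteq> 0 \<longrightarrow>
      defined X (m_query M (m_state M X (answer X) m n)))"
  unfolding defined_iff[of X "pair e m"] machine_asks_iff[OF assms] by blast

lemma machine_conv_to_iff:
  assumes "implements e M"
  shows "fb_conv_to e X m k \<longleftrightarrow> defined X (pair e m) \<and>
    (\<exists>n. m_live M (m_state M X (answer X) m n) = 0 \<and> m_out M (m_state M X (answer X) m n) = k)"
  using assms unfolding fb_conv_to_iff implements_def by blast

lemma machine_converges_iff:
  assumes "implements e M"
  shows "converges X (pair e m) \<longleftrightarrow>
    defined X (pair e m) \<and> (\<exists>n. m_live M (m_state M X (answer X) m n) = 0)"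
  using machine_conv_to_iff[OF assms] by (simp add: converges_def fb_conv_def)

lemma m_step_answer:
  "m_step M X (answer X) s =
     (if m_live M s = 0 then s
      else m_next M (of_bool (X (m_orc M s))) (of_bool (converges X (m_query M s))) s)"
  by (simp add: m_step_def answer_def)

section \<open>Universal simulation\<close>

lemma pr_const: "pr (\<lambda>_. c)"
  by (induction c) (auto intro: pr_zero pr_comp[OF pr_suc])

lemma pr_Suc: "pr f \<Longrightarrow> pr (\<lambda>x. Suc (f x))"
  by (rule pr_comp[OF pr_suc])

lemma pr_pfst: "pr f \<Longrightarrow> pr (\<lambda>x. pfst (f x))"
  by (rule pr_comp[OF pr_fst])

lemma pr_psnd: "pr f \<Longrightarrow> pr (\<lambda>x. psnd (f x))"
  by (rule pr_comp[OF pr_snd])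

text \<open>Iteration with a parameter: \<open>x\<close> is carried along as second component of the
  iterated pair. In the premise \<open>z\<close> packs the current value and the parameter.\<close>

lemma pr_funpow:
  assumes "pr (\<lambda>z. f (psnd z) (pfst z))" "pr n" "pr a"
  shows "pr (\<lambda>x. (f x ^^ n x) (a x))"
proof -
  let ?F = "\<lambda>z. pair (f (psnd z) (pfst z)) (psnd z)"
  have "(?F ^^ i) (pair a x) = pair ((f x ^^ i) a) x" for i a x
    by (induction i) auto
  moreover have "pr (\<lambda>z. (?F ^^ psnd z) (pfst z))"
    by (rule pr_iter[OF pr_pair[OF assms(1) pr_snd]])
  then have "pr (\<lambda>x. pfst ((?F ^^ psnd (pair (pair (a x) x) (n x))) (pfst (pair (pair (a x) x) (n x)))))"
    by (rule pr_pfst[OF pr_comp[OF _ pr_pair[OF pr_pair[OF assms(3) pr_id] assms(2)]]])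
  ultimately show ?thesis by simp
qed

text \<open>Iterating on pairs of counter and value yields recursion. In the premise
  \<open>z\<close> packs counter, previous value and parameter, in this order.\<close>

lemma pr_rec:
  assumes "pr (\<lambda>z. f (psnd (psnd z)) (pfst z) (pfst (psnd z)))" "pr n" "pr a"
  shows "pr (\<lambda>x. rec_nat (a x) (f x) (n x))"
proof -
  let ?F = "\<lambda>x z. pair (Suc (pfst z)) (f x (pfst z) (psnd z))"
  have "(?F x ^^ i) (pair 0 a) = pair i (rec_nat a (f x) i)" for i a x
    by (induction i) auto
  moreover have "pr (\<lambda>x. psnd ((?F x ^^ n x) (pair 0 (a x))))"
  proof (intro pr_psnd pr_funpow pr_pair pr_Suc pr_pfst pr_id pr_const assms(2,3))
    have "pr (\<lambda>z. f (psnd (psnd (h z))) (pfst (h z)) (pfst (psnd (h z))))"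
      if "pr h" for h by (rule pr_comp[OF assms(1) that])
    from this[of "\<lambda>z. pair (pfst (pfst z)) (pair (psnd (pfst z)) (psnd z))"]
    show "pr (\<lambda>z. f (psnd z) (pfst (pfst z)) (psnd (pfst z)))"
      by (simp add: pr_pair pr_pfst pr_psnd pr_id)
  qed
  ultimately show ?thesis by simp
qed

lemma pr_if_zero:
  assumes "pr c" "pr a" "pr b"
  shows "pr (\<lambda>x. if c x = 0 then a x else b x)"
proof -
  have "(if c x = 0 then a x else b x) = rec_nat (a x) (\<lambda>_ _. b x) (c x)" for x
    by (cases "c x") auto
  then show ?thesis
    using assms pr_comp[OF assms(3) pr_psnd[OF pr_snd]] by (simp add: pr_rec)
qed

lemma pr_add:
  assumes "pr f" "pr g"
  shows "pr (\<lambda>x. f x + g x)"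
proof -
  have "pr (\<lambda>x. (Suc ^^ f x) (g x))"
    by (intro pr_funpow pr_Suc pr_pfst pr_id assms)
  moreover have "(Suc ^^ n) m = n + m" for n m by (induction n) auto
  ultimately show ?thesis by simp
qed

lemma pr_diff:
  assumes "pr f" "pr g"
  shows "pr (\<lambda>x. f x - g x)"
proof -
  have pred: "pr (\<lambda>x. f x - Suc 0)" if "pr f" for f
  proof -
    have "f x - Suc 0 = rec_nat 0 (\<lambda>i _. i) (f x)" for x by (cases "f x") auto
    then show ?thesis using that by (simp add: pr_rec pr_pfst pr_id pr_const)
  qed
  have "((\<lambda>y. y - Suc 0) ^^ n) m = m - n" for n m by (induction n) auto
  then show ?thesis
    using pr_funpow[of "\<lambda>_ y. y - Suc 0" g f] assms by (simp add: pred pr_pfst pr_id)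
qed

abbreviation pr_rel :: "(nat \<Rightarrow> bool) \<Rightarrow> bool" where
  "pr_rel P \<equiv> pr (\<lambda>x. of_bool (P x))"

lemma pr_If:
  assumes "pr_rel P" "pr a" "pr b"
  shows "pr (\<lambda>x. if P x then a x else b x)"
proof -
  have "(if of_bool (P x) = (0::nat) then b x else a x) = (if P x then a x else b x)" for x by simp
  then show ?thesis using pr_if_zero[OF assms(1,3,2)] by simp
qed

lemma pr_eq:
  assumes "pr f" "pr g"
  shows "pr_rel (\<lambda>x. f x = g x)"
proof -
  have "(if (f x - g x) + (g x - f x) = 0 then 1 else 0) = (of_bool (f x = g x) :: nat)" for x by auto
  moreover have "pr (\<lambda>x. if (f x - g x) + (g x - f x) = 0 then 1 else 0)"
    by (intro pr_if_zero pr_add pr_diff pr_const assms)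
  ultimately show ?thesis by simp
qed

lemma pr_not: "pr_rel P \<Longrightarrow> pr_rel (\<lambda>x. \<not> P x)"
proof -
  assume "pr_rel P"
  then have "pr (\<lambda>x. if P x then 0 else 1)" by (intro pr_If pr_const)
  moreover have "(if P x then 0 else 1) = (of_bool (\<not> P x) :: nat)" for x by simp
  ultimately show ?thesis by simp
qed

lemma pr_conj: "pr_rel P \<Longrightarrow> pr_rel Q \<Longrightarrow> pr_rel (\<lambda>x. P x \<and> Q x)"
proof -
  assume "pr_rel P" "pr_rel Q"
  then have "pr (\<lambda>x. if P x then of_bool (Q x) else 0)" by (intro pr_If pr_const)
  moreover have "(if P x then of_bool (Q x) else 0) = (of_bool (P x \<and> Q x) :: nat)" for x by simp
  ultimately show ?thesis by simp
qed

lemma pr_mod: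
  assumes "pr f" "pr g"
  shows "pr (\<lambda>x. f x mod g x)"
proof -
  have "m mod n = rec_nat 0 (\<lambda>_ r. if Suc r = n then 0 else Suc r) m" for m n :: nat
    by (induction m) (simp_all add: mod_Suc)
  moreover have "pr (\<lambda>x. rec_nat 0 (\<lambda>_ r. if Suc r = g x then 0 else Suc r) (f x))"
    by (intro pr_rec pr_If pr_eq pr_Suc pr_const pr_pfst pr_psnd pr_id assms pr_comp[OF assms(2)])
  ultimately show ?thesis by simp
qed

lemma pr_div:
  assumes "pr f" "pr g"
  shows "pr (\<lambda>x. f x div g x)"
proof -
  have "m div n = rec_nat 0 (\<lambda>i r. if Suc i mod n = 0 then Suc r else r) m" for m n :: nat
    by (induction m) (simp_all add: div_Suc)
  moreover have "pr (\<lambda>x. rec_nat 0 (\<lambda>i r. if Suc i mod g x = 0 then Suc r else r) (f x))"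
    by (intro pr_rec pr_If pr_eq pr_Suc pr_const pr_pfst pr_psnd pr_id assms pr_mod pr_comp[OF assms(2)])
  ultimately show ?thesis by simp
qed

lemma pr_double: "pr f \<Longrightarrow> pr (\<lambda>x. 2 * f x)"
  using pr_add[of f f] by (simp add: mult_2)

lemma pr_odd: "pr f \<Longrightarrow> pr_rel (\<lambda>x. odd (f x))"
  unfolding odd_iff_mod_2_eq_one by (intro pr_eq pr_mod pr_const)

lemmas pr_intros = pr_id pr_const pr_Suc pr_pfst pr_psnd pr_pair pr_If pr_eq pr_not pr_conj
  pr_add pr_diff pr_mod pr_div pr_double pr_odd

section \<open>Numbers as infinite streams\<close>

definition stream_nth :: "nat \<Rightarrow> nat \<Rightarrow> nat" where
  "stream_nth t z = pfst ((psnd ^^ t) z)"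

fun stream_upd :: "nat \<Rightarrow> nat \<Rightarrow> nat \<Rightarrow> nat" where
  "stream_upd 0 v z = pair v (psnd z)"
| "stream_upd (Suc t) v z = pair (pfst z) (stream_upd t v (psnd z))"

lemma stream_nth_0: "stream_nth 0 z = pfst z" and
  stream_nth_Suc: "stream_nth (Suc t) z = stream_nth t (psnd z)"
  by (simp_all add: stream_nth_def funpow_swap1)

lemma stream_nth_upd [simp]:
  "stream_nth i (stream_upd t v z) = (if i = t then v else stream_nth i z)"
proof (induction t arbitrary: i z)
  case 0
  then show ?case by (cases i) (auto simp: stream_nth_0 stream_nth_Suc)
next
  case (Suc t)
  then show ?case by (cases i) (auto simp: stream_nth_0 stream_nth_Suc)
qed

lemma zero_components [simp]: "pfst 0 = 0" "psnd 0 = 0"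
  by (simp_all add: pfst_def psnd_def prod_decode_def prod_decode_aux.simps)

lemma stream_nth_zero [simp]: "stream_nth t 0 = 0"
  by (induction t) (simp_all add: stream_nth_0 stream_nth_Suc)

lemma pr_stream_nth: "pr f \<Longrightarrow> pr g \<Longrightarrow> pr (\<lambda>x. stream_nth (f x) (g x))"
  unfolding stream_nth_def by (intro pr_pfst pr_funpow pr_psnd pr_id)

text \<open>The recursion in \<open>stream_upd\<close> is not primitive; a zipper turns it into two iterations.\<close>

lemma pr_stream_upd:
  assumes "pr f" "pr g" "pr h"
  shows "pr (\<lambda>x. stream_upd (f x) (g x) (h x))"
proof -
  define down where "down z = pair (pair (pfst (psnd z)) (pfst z)) (psnd (psnd z))" for z
  define up where "up z = pair (psnd (pfst z)) (pair (pfst (pfst z)) (psnd z))" for z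
  define set where "set v z = pair (pfst z) (pair v (psnd (psnd z)))" for v z
  have "(up ^^ t) (set v ((down ^^ t) (pair y z))) = pair y (stream_upd t v z)" for t v y z
  proof (induction t arbitrary: y z)
    case (Suc t)
    have "(down ^^ Suc t) (pair y z) = (down ^^ t) (pair (pair (pfst z) y) (psnd z))"
      by (simp add: funpow_swap1 down_def)
    then show ?case using Suc by (simp add: up_def)
  qed (simp add: set_def)
  then have "stream_upd t v z = psnd ((up ^^ t) (set v ((down ^^ t) (pair 0 z))))" for t v z
    by simp
  moreover have "pr (\<lambda>x. psnd ((up ^^ f x) (set (g x) ((down ^^ f x) (pair 0 (h x))))))"
    unfolding set_def up_def down_def by (intro pr_funpow pr_intros assms)
  ultimately show ?thesis by simp
qed

section \<open>Coding of tapes, programs and configurations\<close>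

fun bits :: "bool list \<Rightarrow> nat" where
  "bits [] = 0"
| "bits (b # bs) = of_bool b + 2 * bits bs"

lemma odd_bits: "odd (bits bs) \<longleftrightarrow> bs \<noteq> [] \<and> hd bs" and bits_div_2: "bits bs div 2 = bits (tl bs)"
  by (cases bs; simp)+

text \<open>On either side the cell nearest to the head is the lowest bit, so blanks listed at the
  far ends do not affect the code. The tape value is stored as well, which spares counting
  bits.\<close>

definition tape_code :: "tape \<Rightarrow> nat" where
  "tape_code t = pair (bits (fst t)) (pair (bits (snd t)) (tape_val t))"

text \<open>Moving the head shifts one bit from one half tape to the other. \<open>r'\<close> is the
  right half after writing, and \<open>n\<close> is the tape value corrected for the old and the new
  symbol.\<close>

definition code_act :: "nat \<Rightarrow> nat \<Rightarrow> nat" where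
  "code_act a z =
     (let l = pfst z; r = pfst (psnd z); b = a mod 2; r' = 2 * (r div 2) + b;
          n = psnd (psnd z) - r mod 2 + b; d = a div 2 mod 3
      in if d = 0 then pair (l div 2) (pair (2 * r' + l mod 2) n)
         else if d = 1 then pair (2 * l + b) (pair (r div 2) n)
         else pair l (pair r' n))"

lemma tape_val_move: "tape_val (move d t) = tape_val t"
  by (cases t; cases d; cases "fst t"; cases "snd t") auto

lemma tape_val_put: "tape_val (put b t) = tape_val t - of_bool (scanned t) + of_bool b"
  by (cases t; cases "snd t") auto

lemma code_act_correct:
  assumes "decode_action a = (b, d, q)"
  shows "code_act a (tape_code t) = tape_code (move d (put b t))" and "a div 6 = q"
proof -
  obtain l r where t: "t = (l, r)" by (cases t)
  have mod: "bits xs mod 2 = of_bool (xs \<noteq> [] \<and> hd xs)" for xs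
    using odd_bits[of xs] by (auto simp: mod2_eq_if)
  have d: "a div 2 mod 3 = 0 \<Longrightarrow> d = Left" "a div 2 mod 3 = Suc 0 \<Longrightarrow> d = Right"
    "a div 2 mod 3 \<noteq> 0 \<Longrightarrow> a div 2 mod 3 \<noteq> Suc 0 \<Longrightarrow> d = Stay" and b: "a mod 2 = of_bool b"
    using assms by (auto simp: decode_action_def odd_iff_mod_2_eq_one split: if_splits)
  show "code_act a (tape_code t) = tape_code (move d (put b t))"
    using d unfolding code_act_def tape_code_def Let_def b tape_val_move tape_val_put
    by (auto simp: t mod bits_div_2)
  show "a div 6 = q" using assms by (simp add: decode_action_def)
qed

text \<open>For the code \<open>y\<close> of a nonempty list, \<open>psnd (y - 1)\<close> codes the
  tail; truncated subtraction makes 0, the empty list, its own tail.\<close>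

definition code_rest :: "nat \<Rightarrow> nat \<Rightarrow> nat" where
  "code_rest e q = ((\<lambda>y. psnd (y - 1)) ^^ q) e"

lemma code_rest: "code_rest e q = list_encode (drop q (list_decode e))"
proof (induction q)
  case (Suc q)
  have "psnd (list_encode xs - 1) = list_encode (tl xs)" for xs
    by (cases xs) simp_all
  then show ?case using Suc by (simp add: code_rest_def drop_Suc tl_drop)
qed (simp add: code_rest_def)

text \<open>
  A configuration \<open>(q, T)\<close> is coded by \<open>q\<close> paired with a stream of codes of tapes: reading
  \<open>pair a z\<close> as the stream with head \<open>a\<close> and tail \<open>z\<close>, the number 0 codes blank tapes throughout.
\<close>

definition codes_config :: "config \<Rightarrow> nat \<Rightarrow> bool" where
  "codes_config c z \<longleftrightarrow> pfst z = fst c \<and> (\<forall>t. stream_nth t (psnd z) = tape_code (snd c t))"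

text \<open>Kinds 0, 1, 2 follow \<open>decode_instr\<close>; 3 marks a state beyond the program,
  that is, a halted run.\<close>

definition code_kind :: "nat \<Rightarrow> nat \<Rightarrow> nat" where
  "code_kind e z =
     (let y = code_rest e (pfst z) in if y = 0 then 3 else pfst (y - 1) mod 3)"

definition code_operands :: "nat \<Rightarrow> nat \<Rightarrow> nat" where
  "code_operands e z = pfst (code_rest e (pfst z) - 1) div 3"

definition code_tape_val :: "nat \<Rightarrow> nat \<Rightarrow> nat" where
  "code_tape_val t z = psnd (psnd (stream_nth t (psnd z)))"

definition sim_orc :: "nat \<Rightarrow> nat \<Rightarrow> nat" where
  "sim_orc e z = code_tape_val (pfst (code_operands e z)) z"

definition sim_arg :: "nat \<Rightarrow> nat \<Rightarrow> nat" where
  "sim_arg e z = code_tape_val (pfst (psnd (code_operands e z))) z"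

definition sim_step :: "nat \<Rightarrow> nat \<Rightarrow> nat \<Rightarrow> nat \<Rightarrow> nat" where
  "sim_step x y e z =
     (let w = code_operands e z; t = pfst w; c = pfst (psnd w); d = psnd (psnd w); k = code_kind e z in
      if k = 0 then
        (let u = stream_nth t (psnd z); a = if odd (pfst (psnd u)) then d else c
         in pair (a div 6) (stream_upd t (code_act a u) (psnd z)))
      else if k = 1 then pair (if x = 0 then d else c) (psnd z)
      else if k = 2 then pair (if y = 0 then psnd d else pfst d) (psnd z)
      else z)"

lemma code_instr:
  assumes "pfst z = q"
  shows "length (prog e) \<le> q \<Longrightarrow> code_kind e z = 3"
    and "q < length (prog e) \<Longrightarrow> \<exists>i. prog e ! q = decode_instr i \<and> code_kind e z = i mod 3 \<and>
      code_operands e z = i div 3"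
proof -
  have len: "length (prog e) = length (list_decode e)" by (simp add: prog_def)
  show "length (prog e) \<le> q \<Longrightarrow> code_kind e z = 3"
    using assms by (simp add: code_kind_def code_rest len)
  assume q: "q < length (prog e)"
  then have "code_rest e q = Suc (pair (list_decode e ! q) (list_encode (drop (Suc q) (list_decode e))))"
    unfolding code_rest len by (simp flip: Cons_nth_drop_Suc)
  then show "\<exists>i. prog e ! q = decode_instr i \<and> code_kind e z = i mod 3 \<and> code_operands e z = i div 3"
    using assms q by (intro exI[of _ "list_decode e ! q"])
      (simp add: code_kind_def code_operands_def Let_def prog_def)
qed

lemma code_tape_val: "codes_config c z \<Longrightarrow> code_tape_val t z = tape_val (snd c t)"
  by (simp add: codes_config_def code_tape_val_def tape_code_def)

lemma prod_decode_components: "prod_decode n = (pfst n, psnd n)"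
  by (simp add: pfst_def psnd_def)

lemma decode_instr_components:
  "decode_instr n =
     (let w = n div 3; t = pfst w; c = pfst (psnd w); d = psnd (psnd w) in
      if n mod 3 = 0 then Act t (decode_action c) (decode_action d)
      else if n mod 3 = 1 then Oracle t c d
      else Query t c (pfst d) (psnd d))"
  by (simp add: decode_instr_def prod_decode_components Let_def)

lemma sim_queries:
  assumes "codes_config c z"
  shows "queries (prog e) c e' m' \<longleftrightarrow>
    code_kind e z = 2 \<and> e' = sim_orc e z \<and> m' = sim_arg e z"
proof (cases "halted (prog e) c")
  case True
  then show ?thesis
    using code_instr(1)[of z "fst c" e] assms by (simp add: queries_def halted_def codes_config_def)
next
  case False
  then obtain i where i: "prog e ! fst c = decode_instr i" "code_kind e z = i mod 3"
      "code_operands e z = i div 3"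
    using code_instr(2)[of z "fst c" e] assms by (auto simp: halted_def codes_config_def)
  have "i mod 3 < 3" by simp
  then show ?thesis
    using False unfolding queries_def i sim_orc_def sim_arg_def code_tape_val[OF assms]
    by (auto simp: decode_instr_components Let_def)
qed

text \<open>The bit \<open>y\<close> has to be right only at an actual query; elsewhere the
  simulation asks a dummy query and ignores the answer.\<close>

lemma sim_step:
  assumes "codes_config c z" "code_kind e z = 2 \<Longrightarrow> y = of_bool (A (sim_orc e z) (sim_arg e z))"
  shows "codes_config (step X A (prog e) c) (sim_step (of_bool (X (sim_orc e z))) y e z)"
proof (cases "halted (prog e) c")
  case True
  then show ?thesis
    using code_instr(1)[of z "fst c" e] assms
    by (simp add: step_def halted_def codes_config_def sim_step_def)
next
  case False
  obtain q T where c: "c = (q, T)" by (cases c)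
  obtain i where i: "prog e ! q = decode_instr i" "code_kind e z = i mod 3"
      "code_operands e z = i div 3"
    using code_instr(2)[of z "fst c" e] assms False by (auto simp: halted_def codes_config_def c)
  define t where "t = pfst (i div 3)"
  define k where "k = pfst (psnd (i div 3))"
  define l where "l = psnd (psnd (i div 3))"
  have vals: "sim_orc e z = tape_val (T t)" "sim_arg e z = tape_val (T k)"
    unfolding sim_orc_def sim_arg_def i code_tape_val[OF assms(1)] by (simp_all add: c t_def k_def)
  have T: "stream_nth t (psnd z) = tape_code (T t)" for t
    using assms(1) by (simp add: codes_config_def c)
  have "i mod 3 < 3" by simp
  then consider "i mod 3 = 0" | "i mod 3 = 1" | "i mod 3 = 2" by linarith
  then show ?thesis
  proof cases
    case 1
    let ?a = "if scanned (T t) then l else k"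
    obtain b d q' where a: "decode_action ?a = (b, d, q')" by (cases "decode_action ?a")
    have "prog e ! q = Act t (decode_action k) (decode_action l)"
      unfolding i decode_instr_components by (simp add: 1 Let_def t_def k_def l_def)
    then have "step X A (prog e) c = (q', T(t := move d (put b (T t))))"
      using False a by (simp add: step_def c split: if_splits)
    moreover have "scanned (T t) \<longleftrightarrow> odd (pfst (psnd (tape_code (T t))))"
      by (cases "T t") (simp add: tape_code_def odd_bits)
    then have "sim_step x y e z = pair (?a div 6) (stream_upd t (code_act ?a (tape_code (T t))) (psnd z))" for x
      unfolding sim_step_def i Let_def by (simp add: 1 T flip: t_def k_def l_def)
    ultimately show ?thesis
      using code_act_correct(1)[OF a, of "T t"] code_act_correct(2)[OF a] by (simp add: codes_config_def T)
  next
    case 2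
    have "prog e ! q = Oracle t k l"
      unfolding i decode_instr_components by (simp add: 2 Let_def t_def k_def l_def)
    then have "step X A (prog e) c = (if X (tape_val (T t)) then k else l, T)"
      using False by (simp add: step_def c)
    moreover have "sim_step x y e z = pair (if x = 0 then l else k) (psnd z)" for x
      unfolding sim_step_def i Let_def by (simp add: 2 flip: t_def k_def l_def)
    ultimately show ?thesis by (simp add: codes_config_def T vals)
  next
    case 3
    have "prog e ! q = Query t k (pfst l) (psnd l)"
      unfolding i decode_instr_components by (simp add: 3 Let_def t_def k_def l_def)
    then have "step X A (prog e) c = (if A (tape_val (T t)) (tape_val (T k)) then pfst l else psnd l, T)"
      using False by (simp add: step_def c)
    moreover have "sim_step x y e z = pair (if y = 0 then psnd l else pfst l) (psnd z)" for x
      unfolding sim_step_def i Let_def by (simp add: 3 flip: t_def k_def l_def)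
    moreover have "y = of_bool (A (tape_val (T t)) (tape_val (T k)))"
      using assms(2) i 3 vals by simp
    ultimately show ?thesis by (simp add: codes_config_def T)
  qed
qed

text \<open>Iterating \<open>\<lambda>b. Suc (2 * b)\<close> from 0 yields the number with
  \<open>m\<close> binary digits 1, which is the half tape left of the head.\<close>

definition sim_init :: "nat \<Rightarrow> nat" where
  "sim_init m = pair 0 (pair (pair (((\<lambda>b. Suc (2 * b)) ^^ m) 0) (pair 0 m)) 0)"

lemma codes_config_init: "codes_config (init m) (sim_init m)"
proof -
  have "((\<lambda>b. Suc (2 * b)) ^^ m) 0 = bits (replicate m True)" by (induction m) auto
  moreover have "tape_val (replicate m True, []) = m" by (simp add: count_list_replicate_self)
  moreover have "tape_code ([], []) = 0" by (simp add: tape_code_def prod_encode_def)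
  ultimately have "stream_nth t (psnd (sim_init m)) = tape_code (snd (init m) t)" for t
    by (cases t) (simp_all add: stream_nth_0 stream_nth_Suc sim_init_def init_def tape_code_def)
  then show ?thesis by (simp add: codes_config_def sim_init_def init_def)
qed

lemma pr_code_rest: "pr f \<Longrightarrow> pr g \<Longrightarrow> pr (\<lambda>x. code_rest (f x) (g x))"
  unfolding code_rest_def by (intro pr_funpow pr_intros)

lemma pr_code_kind: "pr f \<Longrightarrow> pr g \<Longrightarrow> pr (\<lambda>x. code_kind (f x) (g x))"
  unfolding code_kind_def Let_def by (intro pr_code_rest pr_intros)

lemma pr_code_operands: "pr f \<Longrightarrow> pr g \<Longrightarrow> pr (\<lambda>x. code_operands (f x) (g x))"
  unfolding code_operands_def Let_def by (intro pr_code_rest pr_intros)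

lemma pr_code_tape_val: "pr f \<Longrightarrow> pr g \<Longrightarrow> pr (\<lambda>x. code_tape_val (f x) (g x))"
  unfolding code_tape_val_def by (intro pr_stream_nth pr_intros)

lemma pr_sim_orc: "pr f \<Longrightarrow> pr g \<Longrightarrow> pr (\<lambda>x. sim_orc (f x) (g x))"
  unfolding sim_orc_def by (intro pr_code_tape_val pr_code_operands pr_intros)

lemma pr_sim_arg: "pr f \<Longrightarrow> pr g \<Longrightarrow> pr (\<lambda>x. sim_arg (f x) (g x))"
  unfolding sim_arg_def by (intro pr_code_tape_val pr_code_operands pr_intros)

lemma pr_code_act: "pr f \<Longrightarrow> pr g \<Longrightarrow> pr (\<lambda>x. code_act (f x) (g x))"
  unfolding code_act_def Let_def by (intro pr_intros)

lemma pr_sim_step: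
  assumes "pr f" "pr g" "pr h" "pr k"
  shows "pr (\<lambda>x. sim_step (f x) (g x) (h x) (k x))"
  unfolding sim_step_def Let_def
  by (intro pr_stream_nth pr_stream_upd pr_code_act pr_code_kind pr_code_operands pr_intros assms)

lemma pr_sim_init: "pr f \<Longrightarrow> pr (\<lambda>x. sim_init (f x))"
  unfolding sim_init_def by (intro pr_funpow pr_intros)

section \<open>Selection among computations\<close>

definition sim_start :: "nat \<Rightarrow> nat" where
  "sim_start x = pair (pfst x) (sim_init (psnd x))"

definition at_query :: "nat \<Rightarrow> bool" where
  "at_query u \<longleftrightarrow> code_kind (pfst u) (psnd u) = 2"

definition sim_oracle :: "nat \<Rightarrow> nat" where
  "sim_oracle u = sim_orc (pfst u) (psnd u)"

definition sim_query :: "nat \<Rightarrow> nat" where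
  "sim_query u = (if at_query u then pair (sim_orc (pfst u) (psnd u)) (sim_arg (pfst u) (psnd u)) else 0)"

definition sim_move :: "nat \<Rightarrow> nat \<Rightarrow> nat \<Rightarrow> nat" where
  "sim_move b q u = pair (pfst u) (sim_step b q (pfst u) (psnd u))"

fun sim :: "(nat \<Rightarrow> bool) \<Rightarrow> nat \<Rightarrow> nat \<Rightarrow> nat" where
  "sim X x 0 = sim_start x"
| "sim X x (Suc n) =
     (let u = sim X x n
      in sim_move (of_bool (X (sim_oracle u))) (of_bool (converges X (sim_query u))) u)"

lemma sim_codes:
  "pfst (sim X x n) = pfst x \<and>
   codes_config (run X (answer X) (pfst x) (psnd x) n) (psnd (sim X x n))"
proof (induction n)
  case 0
  show ?case by (simp add: sim_start_def run_def codes_config_init)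
next
  case (Suc n)
  let ?u = "sim X x n" and ?c = "run X (answer X) (pfst x) (psnd x) n"
  have "codes_config (step X (answer X) (prog (pfst ?u)) ?c)
      (sim_step (of_bool (X (sim_oracle ?u))) (of_bool (converges X (sim_query ?u))) (pfst ?u) (psnd ?u))"
    unfolding sim_oracle_def
    by (rule sim_step; use Suc in simp) (simp add: sim_query_def at_query_def answer_def)
  then show ?case using Suc by (simp add: sim_move_def run_def Let_def)
qed

lemma asks_iff_sim: "asks X x q \<longleftrightarrow> (\<exists>n. at_query (sim X x n) \<and> q = sim_query (sim X x n))"
proof -
  have "queries (prog (pfst x)) (run X (answer X) (pfst x) (psnd x) n) (pfst q) (psnd q) \<longleftrightarrow>
      at_query (sim X x n) \<and> q = sim_query (sim X x n)" for n
  proof -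
    have "q = pair a b \<longleftrightarrow> pfst q = a \<and> psnd q = b" for a b
      by (metis pair_eta pfst_pair psnd_pair)
    then show ?thesis
      using sim_queries[of _ "psnd (sim X x n)" "pfst (sim X x n)"] sim_codes[of X x n]
      by (simp add: at_query_def sim_query_def)
  qed
  then show ?thesis by (simp add: asks_def)
qed

lemma defined_0: "defined X 0"
proof -
  have "\<not> asks X 0 q" for q
    by (simp add: asks_def queries_def halted_def prog_def list_decode.simps(1))
  then show ?thesis by (subst defined_iff) simp
qed

text \<open>The dummy query 0 is defined, so stages that are not at a query add no
  condition.\<close>

lemma defined_iff_sim: "defined X x \<longleftrightarrow> (\<forall>n. defined X (sim_query (sim X x n)))"
  unfolding defined_iff[of X x] asks_iff_sim using defined_0 by (metis sim_query_def)

section \<open>The race between two computations\<close>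

definition compare :: "nat \<Rightarrow> nat \<Rightarrow> nat \<Rightarrow> nat" where
  "compare c x y = pair c (pair c (pair x y))"

text \<open>
  \<open>n\<close> counts the moves that the left simulation \<open>u\<close> has still to make; the phase \<open>d\<close> is 0 while it is
  being decided who moves, 1 when \<open>u\<close> moves and 2 when \<open>v\<close> moves.  The program \<open>c\<close> is meant to
  converge on \<open>pair c (pair x y)\<close> if \<open>y\<close> wins the comparison and to diverge if \<open>x\<close> wins; it is part
  of its own input so that no recursion theorem is needed.
\<close>

definition race_state :: "nat \<Rightarrow> nat \<Rightarrow> nat \<Rightarrow> nat \<Rightarrow> nat \<Rightarrow> nat" where
  "race_state n d c u v = pair n (pair d (pair c (pair u v)))"

definition race_next :: "nat \<Rightarrow> nat \<Rightarrow> nat \<Rightarrow> nat \<Rightarrow> nat \<Rightarrow> nat \<Rightarrow> nat \<Rightarrow> nat" where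
  "race_next b q n d c u v =
     (if d = 0 then race_state n
        (if \<not> at_query u then 1 else if \<not> at_query v then 2 else if q = 0 then 1 else 2) c u v
      else if d = 1 then race_state (n - 1) 0 c (sim_move b q u) v
      else race_state n 0 c u (sim_move b q v))"

definition race_query :: "nat \<Rightarrow> nat \<Rightarrow> nat \<Rightarrow> nat \<Rightarrow> nat" where
  "race_query d c u v =
     (if d = 0 then if at_query u \<and> at_query v then compare c (sim_query u) (sim_query v) else 0
      else if d = 1 then sim_query u else sim_query v)"

text \<open>The input packs \<open>c\<close> and the two computations with a bound \<open>n\<close>;
  the machine halts once the left simulation has made \<open>n\<close> moves.\<close>

definition race :: machine where
  "race = \<lparr>
     m_init = (\<lambda>m. race_state (psnd m) 0 (pfst (pfst m))
       (sim_start (pfst (psnd (pfst m)))) (sim_start (psnd (psnd (pfst m))))),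
     m_live = pfst,
     m_orc = (\<lambda>s. sim_oracle (if pfst (psnd s) = 1 then pfst (psnd (psnd (psnd s)))
       else psnd (psnd (psnd (psnd s))))),
     m_query = (\<lambda>s. race_query (pfst (psnd s)) (pfst (psnd (psnd s)))
       (pfst (psnd (psnd (psnd s)))) (psnd (psnd (psnd (psnd s))))),
     m_next = (\<lambda>b q s. race_next b q (pfst s) (pfst (psnd s)) (pfst (psnd (psnd s)))
       (pfst (psnd (psnd (psnd s)))) (psnd (psnd (psnd (psnd s))))),
     m_out = (\<lambda>_. 0)\<rparr>"

lemma m_live_race [simp]: "m_live race (race_state n d c u v) = n"
  by (simp add: race_def race_state_def)

lemma m_query_race [simp]: "m_query race (race_state n d c u v) = race_query d c u v"
  by (simp add: race_def race_state_def)

lemma pr_race: "pr_machine race"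
  unfolding pr_machine_def race_def machine.simps race_state_def race_next_def race_query_def
    compare_def sim_start_def sim_oracle_def sim_move_def sim_query_def at_query_def
  by (intro conjI pr_sim_init pr_sim_orc pr_sim_arg pr_sim_step pr_code_kind pr_intros)

text \<open>A simulation that is not at a query advances at no risk. If both are at queries and the
  comparison of these is correct, its divergence says that the left query is defined.\<close>

definition moves_left :: "(nat \<Rightarrow> bool) \<Rightarrow> nat \<Rightarrow> nat \<Rightarrow> nat \<Rightarrow> bool" where
  "moves_left X c u v \<longleftrightarrow>
     \<not> at_query u \<or> at_query v \<and> \<not> converges X (compare c (sim_query u) (sim_query v))"

text \<open>The schedule does not mention the bound \<open>n\<close>: all races between the same
  computations follow it and only stop at different times.\<close>

fun race_pos :: "(nat \<Rightarrow> bool) \<Rightarrow> nat \<Rightarrow> nat \<Rightarrow> nat \<Rightarrow> nat \<Rightarrow> nat \<times> nat" where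
  "race_pos X c x y 0 = (0, 0)"
| "race_pos X c x y (Suc k) =
     (let (i, j) = race_pos X c x y k in
      if moves_left X c (sim X x i) (sim X y j) then (Suc i, j) else (i, Suc j))"

definition selects :: "(nat \<Rightarrow> bool) \<Rightarrow> nat \<Rightarrow> nat \<Rightarrow> nat \<Rightarrow> bool" where
  "selects X c x y \<longleftrightarrow> defined X (compare c x y) \<and>
     (if converges X (compare c x y) then defined X y else defined X x)"

definition race_start :: "nat \<Rightarrow> nat \<Rightarrow> nat \<Rightarrow> nat \<Rightarrow> nat" where
  "race_start c x y n = pair (pair c (pair x y)) n"

text \<open>Each move takes two machine steps, one to decide and one to carry it out, so
  \<open>k\<close> moves are complete after \<open>2 * k\<close> steps.\<close>

lemma race_states:
  fixes X c x y
  defines "L \<equiv> \<lambda>k. fst (race_pos X c x y k)" and "R \<equiv> \<lambda>k. snd (race_pos X c x y k)"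
  assumes "\<forall>l<k. L l < n"
  shows "m_state race X (answer X) (race_start c x y n) (2 * k) =
      race_state (n - L k) 0 c (sim X x (L k)) (sim X y (R k))"
    and "L k < n \<Longrightarrow> m_state race X (answer X) (race_start c x y n) (Suc (2 * k)) =
      race_state (n - L k) (if moves_left X c (sim X x (L k)) (sim X y (R k)) then 1 else 2) c
        (sim X x (L k)) (sim X y (R k))"
proof -
  let ?s = "m_state race X (answer X) (race_start c x y n)"
  have odd: "?s (Suc (2 * k)) =
      race_state (n - L k) (if moves_left X c (sim X x (L k)) (sim X y (R k)) then 1 else 2) c
        (sim X x (L k)) (sim X y (R k))"
    if "?s (2 * k) = race_state (n - L k) 0 c (sim X x (L k)) (sim X y (R k))" "L k < n" for k
    using that
    by (auto simp: m_step_answer race_def race_state_def race_next_def race_query_def moves_left_def)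
  show even: "?s (2 * k) = race_state (n - L k) 0 c (sim X x (L k)) (sim X y (R k))"
    using assms(3)
  proof (induction k)
    case 0
    show ?case
      by (simp add: L_def R_def race_def race_start_def)
  next
    case (Suc k)
    have "?s (2 * Suc k) = m_step race X (answer X) (?s (Suc (2 * k)))" by simp
    also have "\<dots> = race_state (n - L (Suc k)) 0 c (sim X x (L (Suc k))) (sim X y (R (Suc k)))"
      using Suc by (subst odd) (auto simp: m_step_answer race_def race_state_def race_next_def
          race_query_def L_def R_def Let_def split: prod.split)
    finally show ?case .
  qed
  show "L k < n \<Longrightarrow> ?s (Suc (2 * k)) =
      race_state (n - L k) (if moves_left X c (sim X x (L k)) (sim X y (R k)) then 1 else 2) c
        (sim X x (L k)) (sim X y (R k))"
    by (rule odd[OF even])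
qed

text \<open>Asks the races with bounds 0, 1, ... in turn and dies in state 0 at the first divergent
  one. If the races are defined, it thus converges iff the left simulation makes only finitely many
  moves, in which case the right one makes infinitely many.\<close>

definition comparison :: "nat \<Rightarrow> machine" where
  "comparison b = \<lparr>
     m_init = (\<lambda>m. pair 1 (pair 0 m)),
     m_live = pfst,
     m_orc = (\<lambda>_. 0),
     m_query = (\<lambda>s. pair b (pair (psnd (psnd s)) (pfst (psnd s)))),
     m_next = (\<lambda>_ q s. if q = 0 then 0 else pair 1 (pair (Suc (pfst (psnd s))) (psnd (psnd s)))),
     m_out = (\<lambda>_. 0)\<rparr>"

lemma pr_comparison: "pr_machine (comparison b)"
  unfolding pr_machine_def comparison_def machine.simps by (intro conjI pr_intros)

text \<open>If comparison is correct on queries, the race asks only defined ones and never freezes.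
  One side then makes infinitely many moves; all its queries have been asked and are defined, so
  that side is itself defined. Neither \<open>x\<close> nor \<open>y\<close> is assumed to be
  defined.\<close>

lemma selectsI:
  assumes b: "implements b race" and c: "implements c (comparison b)"
    and sel: "\<And>q q'. asks X x q \<Longrightarrow> asks X y q' \<Longrightarrow> selects X c q q'"
  shows "selects X c x y"
proof -
  define L where "L k = fst (race_pos X c x y k)" for k
  define R where "R k = snd (race_pos X c x y k)" for k
  note states = race_states[of _ X c x y, folded L_def R_def]
  have sel': "selects X c (sim_query (sim X x i)) (sim_query (sim X y j))"
    if "at_query (sim X x i)" "at_query (sim X y j)" for i j
    using that sel by (auto simp: asks_iff_sim)
  have pos_Suc: "L (Suc k) = (if moves_left X c (sim X x (L k)) (sim X y (R k)) then Suc (L k) else L k)"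
    "R (Suc k) = (if moves_left X c (sim X x (L k)) (sim X y (R k)) then R k else Suc (R k))" for k
    by (simp_all add: L_def R_def split: prod.split)
  have pos_0: "L 0 = 0" "R 0 = 0" by (simp_all add: L_def R_def)
  have def_left: "defined X (sim_query (sim X x (L k)))"
    if "moves_left X c (sim X x (L k)) (sim X y (R k))" for k
    using that sel'[of "L k" "R k"] defined_0[of X]
    unfolding moves_left_def selects_def by (metis sim_query_def)
  have def_right: "defined X (sim_query (sim X y (R k)))"
    if "\<not> moves_left X c (sim X x (L k)) (sim X y (R k))" for k
    using that sel'[of "L k" "R k"] defined_0[of X]
    unfolding moves_left_def selects_def by (metis sim_query_def)
  have visit_left: "defined X (sim_query (sim X x i))" if "i < L k" for i k
    using that
  proof (induction k)
    case (Suc k)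
    then show ?case using def_left[of k] by (auto simp: pos_Suc less_Suc_eq split: if_splits)
  qed (simp add: pos_0)
  have visit_right: "defined X (sim_query (sim X y i))" if "i < R k" for i k
    using that
  proof (induction k)
    case (Suc k)
    then show ?case using def_right[of k] by (auto simp: pos_Suc less_Suc_eq split: if_splits)
  qed (simp add: pos_0)
  have pos_sum: "L k + R k = k" for k
    by (induction k) (auto simp: pos_0 pos_Suc)
  let ?race = "\<lambda>n. pair b (race_start c x y n)"
  let ?s = "\<lambda>n. m_state race X (answer X) (race_start c x y n)"
  have race_defined: "defined X (?race n)" for n
    unfolding machine_defined_iff[OF b]
  proof (intro allI impI)
    fix t assume live: "m_live race (?s n t) \<noteq> 0"
    define k where "k = t div 2"
    have t: "t = 2 * k \<or> t = Suc (2 * k)" unfolding k_def by presburger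
    \<comment> \<open>At the first \<open>l'\<close> where the left side has used up its
      \<open>n\<close> moves the machine is dead, so a live step \<open>t\<close> must come
      earlier.\<close>
    have before: "L l < n" if "l < k \<or> l = k \<and> t = Suc (2 * k) \<or> l = k" for l
    proof (rule ccontr)
      assume "\<not> L l < n"
      define l' where "l' = (LEAST l. \<not> L l < n)"
      have l': "\<not> L l' < n" "l' \<le> l"
        unfolding l'_def using \<open>\<not> L l < n\<close> by (rule LeastI, rule Least_le)
      have "\<forall>l<l'. L l < n" unfolding l'_def using not_less_Least by blast
      have "m_live race (?s n (2 * l')) = 0"
        using states(1)[OF \<open>\<forall>l<l'. L l < n\<close>] l'(1) by simp
      moreover have "2 * l' \<le> t" using l'(2) that t by auto
      ultimately show False using m_state_dead live by metis
    qed
    have s: "?s n (2 * k) = race_state (n - L k) 0 c (sim X x (L k)) (sim X y (R k))"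
      "?s n (Suc (2 * k)) =
      race_state (n - L k) (if moves_left X c (sim X x (L k)) (sim X y (R k)) then 1 else 2) c
        (sim X x (L k)) (sim X y (R k))"
      using states[of k n] before by blast+
    have "defined X (compare c (sim_query (sim X x (L k))) (sim_query (sim X y (R k))))"
      if "at_query (sim X x (L k))" "at_query (sim X y (R k))"
      using sel'[OF that] by (simp add: selects_def)
    then show "defined X (m_query race (?s n t))"
      using t
    proof (elim disjE)
      assume t: "t = Suc (2 * k)"
      show ?thesis
        unfolding t s m_query_race using def_left[of k] def_right[of k]
        by (simp add: race_query_def)
    qed (simp add: s race_query_def defined_0)
  qed
  have race_converges: "converges X (?race n) \<longleftrightarrow> (\<exists>k. n \<le> L k)" for n
  proof
    assume "converges X (?race n)"
    then obtain t where t: "m_live race (?s n t) = 0"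
      unfolding machine_converges_iff[OF b] by blast
    show "\<exists>k. n \<le> L k"
    proof (rule ccontr)
      assume "\<not> (\<exists>k. n \<le> L k)"
      then have "L l < n" for l by (simp add: not_le)
      moreover from this have "m_live race (?s n (2 * t)) \<noteq> 0"
        using states(1)[of t n] by (simp add: not_le)
      ultimately show False using m_state_dead[OF t, of "2 * t"] t by simp
    qed
  next
    assume ex: "\<exists>k. n \<le> L k"
    define k where "k = (LEAST k. n \<le> L k)"
    have "n \<le> L k" unfolding k_def using ex by (rule LeastI_ex)
    moreover have "\<forall>l<k. L l < n" unfolding k_def using not_less_Least not_le by blast
    ultimately have "m_live race (?s n (2 * k)) = 0"
      using states(1)[of k n] by simp
    then show "converges X (?race n)"
      unfolding machine_converges_iff[OF b] using race_defined by blast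
  qed
  let ?w = "pair c (pair x y)"
  let ?t = "m_state (comparison b) X (answer X) ?w"
  have cmp_state: "?t n = (if \<forall>i<n. converges X (?race i) then pair 1 (pair n ?w) else 0)" for n
    by (induction n) (auto simp: m_step_answer comparison_def race_start_def less_Suc_eq)
  have cmp: "compare c x y = pair c ?w" by (simp add: compare_def)
  have cmp_defined: "defined X (compare c x y)"
    unfolding cmp machine_defined_iff[OF c] cmp_state
    using race_defined by (auto simp: comparison_def race_start_def)
  have "m_live (comparison b) (?t n) = 0 \<longleftrightarrow> \<not> (\<forall>i<n. converges X (?race i))" for n
    unfolding cmp_state by (simp add: comparison_def)
  then have cmp_converges: "converges X (compare c x y) \<longleftrightarrow> (\<exists>n. \<not> converges X (?race n))"
    using cmp_defined unfolding cmp machine_converges_iff[OF c] by blast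
  show ?thesis
  proof (cases "converges X (compare c x y)")
    case True
    then obtain n where n: "\<And>k. L k < n"
      unfolding cmp_converges race_converges by (auto simp: not_le)
    \<comment> \<open>Of the first \<open>i + n\<close> moves fewer than \<open>n\<close> are on the
      left, so more than \<open>i\<close> are on the right: stage \<open>i\<close> of
      \<open>y\<close> has been passed.\<close>
    have "i < R (i + n)" for i using pos_sum[of "i + n"] n[of "i + n"] by linarith
    then have "defined X y" unfolding defined_iff_sim[of X y] using visit_right by blast
    then show ?thesis using True cmp_defined by (simp add: selects_def)
  next
    case False
    then have "\<exists>k. Suc i \<le> L k" for i
      unfolding cmp_converges race_converges by blast
    then have "defined X x"
      unfolding defined_iff_sim[of X x] using visit_left by (meson Suc_le_lessD)
    then show ?thesis using False cmp_defined by (simp add: selects_def)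
  qed
qed

text \<open>One defined side is enough, the opponent being arbitrary: by induction, every query of
  \<open>x\<close> is correctly compared with every query of \<open>y\<close>.\<close>

lemma selects_if_defined:
  assumes b: "implements b race" and c: "implements c (comparison b)"
    and "defined X x"
  shows "selects X c x y \<and> selects X c y x"
  using assms(3)
proof (induction arbitrary: y rule: defined_induct)
  case (defined x)
  then show ?case using selectsI[OF b c] by blast
qed

section \<open>Trials of successive witnesses\<close>

text \<open>\<open>Suc (pair p ms)\<close> is the code of the list with head \<open>p\<close> and
  tail coded by \<open>ms\<close>.\<close>

definition candidate :: "nat \<Rightarrow> nat \<Rightarrow> nat \<Rightarrow> nat" where
  "candidate e ms p = pair e (Suc (pair p ms))"

text \<open>The program \<open>h\<close> is again part of its own input, so that it can refer to the
  next trial.\<close>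

definition trial :: "nat \<Rightarrow> nat \<Rightarrow> nat \<Rightarrow> nat" where
  "trial h ms p = pair h (pair h (pair p ms))"

text \<open>
  Phases: 1 compares the candidate with the next trial, 2 asks the candidate, 3 asks the next
  trial, 4 runs forever, 0 halts.
\<close>

definition trial_query :: "nat \<Rightarrow> nat \<Rightarrow> nat \<Rightarrow> nat \<Rightarrow> nat \<Rightarrow> nat \<Rightarrow> nat" where
  "trial_query c e d h p ms =
     (if d = 1 then compare c (candidate e ms p) (trial h ms (Suc p))
      else if d = 2 then candidate e ms p
      else if d = 3 then trial h ms (Suc p)
      else 0)"

definition trials :: "nat \<Rightarrow> nat \<Rightarrow> machine" where
  "trials c e = \<lparr>
     m_init = (\<lambda>m. pair 1 m),
     m_live = pfst,
     m_orc = (\<lambda>_. 0),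
     m_query = (\<lambda>s. trial_query c e (pfst s) (pfst (psnd s)) (pfst (psnd (psnd s))) (psnd (psnd (psnd s)))),
     m_next = (\<lambda>_ q s. pair
       (if pfst s = 1 then if q = 0 then 2 else 3
        else if pfst s = 2 then if q = 0 then 3 else 0
        else 4) (psnd s)),
     m_out = (\<lambda>_. 0)\<rparr>"

lemma pr_trials: "pr_machine (trials c e)"
  unfolding pr_machine_def trials_def machine.simps trial_query_def compare_def candidate_def trial_def
  by (intro conjI pr_intros)

text \<open>Phase 0 is entered only from phase 2, after the candidate was found convergent, and
  every other run passes through phase 3. The answer in phase 3 is ignored; asking is what places
  the next trial below a divergent one in the well-founded order of queries.\<close>

lemma trial_steps:
  fixes X c e h ms p
  assumes h: "implements h (trials c e)"
  defines "z \<equiv> compare c (candidate e ms p) (trial h ms (Suc p))"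
    and "x \<equiv> candidate e ms p" and "y \<equiv> trial h ms (Suc p)"
  shows "converges X (trial h ms p) \<Longrightarrow> converges X x"
    and "defined X (trial h ms p) \<Longrightarrow> \<not> converges X (trial h ms p) \<Longrightarrow> asks X (trial h ms p) y"
    and "defined X z \<Longrightarrow> (converges X z \<Longrightarrow> defined X y) \<Longrightarrow> (\<not> converges X z \<Longrightarrow> defined X x) \<Longrightarrow>
      (\<not> converges X x \<Longrightarrow> defined X y) \<Longrightarrow> defined X (trial h ms p)"
proof -
  let ?m = "pair h (pair p ms)"
  let ?s = "m_state (trials c e) X (answer X) ?m"
  have t: "trial h ms p = pair h ?m" by (simp add: trial_def)
  have s1: "?s (Suc 0) = pair (if converges X z then 3 else 2) ?m"
    by (simp add: m_step_answer trials_def trial_query_def z_def)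
  have s2: "?s (Suc (Suc 0)) = pair (if converges X z then 4 else if converges X x then 0 else 3) ?m"
    by (simp only: m_state_simps(2) s1[unfolded m_state_simps(2)])
      (simp add: m_step_answer trials_def trial_query_def z_def x_def)
  \<comment> \<open>Each phase is recorded with the answers that lead to it; these match the
    premises of the third claim.\<close>
  have s: "\<exists>d. ?s n = pair d ?m \<and> (d = 1 \<or> d = 2 \<and> \<not> converges X z \<or>
      d = 3 \<and> (converges X z \<or> \<not> converges X x) \<or> d = 4 \<or> d = 0 \<and> converges X x)" for n
  proof (induction n)
    case (Suc n)
    then show ?case
      by (auto simp: m_step_answer trials_def trial_query_def z_def x_def)
  qed (simp add: trials_def)
  have live: "m_live (trials c e) (pair d ?m) = d" for d by (simp add: trials_def)
  show "converges X x" if conv: "converges X (trial h ms p)"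
  proof -
    obtain n where "m_live (trials c e) (?s n) = 0"
      using conv unfolding t machine_converges_iff[OF h] by metis
    then show ?thesis using s[of n] live by auto
  qed
  show "asks X (trial h ms p) y" if "defined X (trial h ms p)" "\<not> converges X (trial h ms p)"
  proof -
    have alive: "m_live (trials c e) (?s n) \<noteq> 0" for n
      using that unfolding t machine_converges_iff[OF h] by metis
    have "\<exists>n. ?s n = pair 3 ?m"
    proof (cases "converges X z")
      case True
      then have "?s (Suc 0) = pair 3 ?m" unfolding s1 by (simp only: if_True)
      then show ?thesis by (rule exI)
    next
      case False
      moreover have "\<not> converges X x"
        using alive[of "Suc (Suc 0)"] False unfolding s2 live by (simp split: if_splits)
      ultimately have "?s (Suc (Suc 0)) = pair 3 ?m" unfolding s2 by (simp only: if_False)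
      then show ?thesis by (rule exI)
    qed
    then obtain n where n: "?s n = pair 3 ?m" ..
    have "m_query (trials c e) (?s n) = y"
      unfolding n by (simp add: trials_def trial_query_def y_def)
    then show ?thesis
      using alive[of n] unfolding t machine_asks_iff[OF h] by (intro exI[of _ n]) simp
  qed
  show "defined X (trial h ms p)"
    if "defined X z" "converges X z \<Longrightarrow> defined X y" "\<not> converges X z \<Longrightarrow> defined X x"
      "\<not> converges X x \<Longrightarrow> defined X y"
    unfolding t machine_defined_iff[OF h]
  proof (intro allI impI)
    fix n
    obtain d where d: "?s n = pair d ?m" "d = 1 \<or> d = 2 \<and> \<not> converges X z \<or>
      d = 3 \<and> (converges X z \<or> \<not> converges X x) \<or> d = 4 \<or> d = 0 \<and> converges X x"
      using s by blast
    have "m_query (trials c e) (pair d ?m) = (if d = 1 then z else if d = 2 then x else if d = 3 then y else 0)"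
      by (simp add: trials_def trial_query_def z_def x_def y_def)
    then show "defined X (m_query (trials c e) (?s n))"
      using that d(2) defined_0 unfolding d(1) by auto
  qed
qed

section \<open>Search for the first convergent trial\<close>

definition search :: "nat \<Rightarrow> machine" where
  "search h = \<lparr>
     m_init = (\<lambda>m. pair 1 (pair 0 m)),
     m_live = pfst,
     m_orc = (\<lambda>_. 0),
     m_query = (\<lambda>s. trial h (psnd (psnd s)) (pfst (psnd s))),
     m_next = (\<lambda>_ q s. if q = 0 then pair 1 (pair (Suc (pfst (psnd s))) (psnd (psnd s)))
       else pair 0 (psnd s)),
     m_out = (\<lambda>s. pfst (psnd s))\<rparr>"

lemma pr_search: "pr_machine (search h)"
  unfolding pr_machine_def search_def machine.simps trial_def
  by (intro conjI pr_intros)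

theorem choice:
  "\<exists>f. \<forall>X ms. (\<exists>p. converges X (candidate e ms p)) \<longrightarrow>
     (\<exists>p. fb_conv_to f X ms p \<and> converges X (candidate e ms p))"
proof -
  obtain b where b: "implements b race" using machine_exists[OF pr_race] by blast
  obtain c where c: "implements c (comparison b)" using machine_exists[OF pr_comparison] by blast
  obtain h where h: "implements h (trials c e)" using machine_exists[OF pr_trials] by blast
  obtain f where f: "implements f (search h)" using machine_exists[OF pr_search] by blast
  have "\<exists>p. fb_conv_to f X ms p \<and> converges X (candidate e ms p)"
    if "converges X (candidate e ms p0)" for X ms p0
  proof -
    let ?x = "candidate e ms" and ?h = "trial h ms"
    note sel = selects_if_defined[OF b c, unfolded selects_def]
    \<comment> \<open>The candidate at \<open>p0\<close> is defined, so its comparison is correct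
      whatever the next trial is. As it also converges, the next trial is asked only after winning
      the comparison, hence only if it is defined.\<close>
    have start: "defined X (?h p0)"
      using trial_steps(3)[OF h] that converges_defined[OF that]
        sel[of X "?x p0" "?h (Suc p0)"] by metis
    \<comment> \<open>Here the defined side is the next trial; the candidate is asked only after
      winning the comparison, hence only if it is defined.\<close>
    have down: "defined X (?h p)" if "defined X (?h (Suc p))" for p
      using trial_steps(3)[OF h] that sel[of X "?h (Suc p)" "?x p"] by metis
    have h0: "defined X (?h 0)"
      using start by (induction p0) (use down in blast)+
    have up: "defined X (?h (Suc p))" if "defined X (?h p)" "\<not> converges X (?h p)" for p
      using trial_steps(2)[OF h that] that(1) defined_iff[of X "?h p"] by blast
    \<comment> \<open>Otherwise each trial would ask the next one without end, against the
      well-foundedness of \<open>asks\<close> below a defined computation.\<close>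
    have "z = ?h p \<Longrightarrow> \<exists>p. converges X (?h p)" if "defined X z" for z p
      using that
    proof (induction arbitrary: p rule: defined_induct)
      case (defined z)
      then show ?case using trial_steps(2)[OF h] by metis
    qed
    then have ex: "\<exists>p. converges X (?h p)" using h0 by blast
    define p where "p = (LEAST p. converges X (?h p))"
    have p: "converges X (?h p)" "\<And>i. i < p \<Longrightarrow> \<not> converges X (?h i)"
      unfolding p_def using LeastI_ex[OF ex] not_less_Least by blast+
    \<comment> \<open>Definedness passes from a divergent trial to the next, so it reaches all
      trials up to \<open>p\<close>; the search asks no others.\<close>
    have def_h: "defined X (?h i)" if "i \<le> p" for i
      using that by (induction i) (use h0 up p(2) in auto)
    let ?s = "m_state (search h) X (answer X) ms"
    have s: "?s i = pair 1 (pair i ms)" if "i \<le> p" for i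
      using that by (induction i) (use p(2) in \<open>auto simp: m_step_answer search_def\<close>)
    have last: "?s (Suc p) = pair 0 (pair p ms)"
      using s[of p] p(1) by (simp add: m_step_answer search_def)
    have dead: "m_live (search h) (?s (Suc p)) = 0" unfolding last by (simp add: search_def)
    have "defined X (pair f ms)"
      unfolding machine_defined_iff[OF f]
    proof (intro allI impI)
      fix i assume "m_live (search h) (?s i) \<noteq> 0"
      then have "i \<le> p" using m_state_dead[OF dead, of i] dead by (metis not_less_eq_eq)
      then show "defined X (m_query (search h) (?s i))"
        using s[of i] def_h[of i] by (simp add: search_def)
    qed
    moreover have "m_out (search h) (?s (Suc p)) = p"
      unfolding last by (simp add: search_def)
    ultimately have "fb_conv_to f X ms p"
      unfolding machine_conv_to_iff[OF f] using dead by blast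
    then show ?thesis using trial_steps(1)[OF h p(1)] by blast
  qed
  then show ?thesis by blast
qed

section \<open>From codes of tuples back to the relation\<close>

theorem theorem2p35:
  fixes n :: nat
    and R :: "nat \<Rightarrow> nat list \<Rightarrow> (nat \<Rightarrow> bool) \<Rightarrow> bool"
  assumes "fb_semicomputable n R"
    and "\<forall>ms X. length ms = n \<longrightarrow> (\<exists>p. R p ms X)"
  shows "\<exists>F :: nat list \<Rightarrow> (nat \<Rightarrow> bool) \<Rightarrow> nat option.
           partial_fb_computable n F \<and>
           (\<forall>ms X. length ms = n \<longrightarrow> (\<exists>k. F ms X = Some k \<and> R k ms X))"
proof -
  obtain e where e: "\<And>p ms X. length ms = n \<Longrightarrow> R p ms X \<longleftrightarrow> fb_conv e X (list_encode (p # ms))"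
    using assms(1) unfolding fb_semicomputable_def by blast
  have R: "R p ms X \<longleftrightarrow> converges X (candidate e (list_encode ms) p)" if "length ms = n" for p ms X
    using e[OF that] by (simp add: converges_def candidate_def)
  obtain f where f: "\<And>X ms p. converges X (candidate e ms p) \<Longrightarrow>
      \<exists>p. fb_conv_to f X ms p \<and> converges X (candidate e ms p)"
    using choice[of e] by blast
  have unique: "k = l" if "fb_conv_to f X m k" "fb_conv_to f X m l" for X m k l
    using that single_valuedD[OF single_valued_I_infty] unfolding fb_conv_to_def by blast
  \<comment> \<open>\<open>THE\<close> picks the only possible value because \<open>I_infty\<close>
    is single-valued; the default \<open>None\<close> covers the inputs on which the program does
    not converge.\<close>
  define F where "F ms X =
      (if fb_conv f X (list_encode ms) then Some (THE k. fb_conv_to f X (list_encode ms) k) else None)"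
    for ms X
  have F: "F ms X = Some k \<longleftrightarrow> fb_conv_to f X (list_encode ms) k" for ms X k
    using unique by (auto simp: F_def fb_conv_def intro: theI2 the_equality)
  have "partial_fb_computable n F"
    unfolding partial_fb_computable_def using F by blast
  moreover have "\<exists>k. F ms X = Some k \<and> R k ms X" if "length ms = n" for ms X
    using assms(2) that f unfolding F by (metis R)
  ultimately show ?thesis by blast
qed

end
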